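(* Let $E$ be a graph and let $R$ be a unital commutative ring. Then the following are equivalent. (1) $L_R(E)$ is a prime ring. (2) $R$ is an integral domain and $E$ satisfies Condition (MT3): for every $v,w\in E^0$ there exists $y\in E^0$ such that $v\geq y$ and $w\geq y$. (3) $R$ is an integral domain and $I\cap J\cap E^0\neq\emptyset$ for all nonzero graded basic ideals $I$ and $J$ of $L_R(E)$.
   Context: A graph $E=(E^0,E^1,r,s)$ consists of countable sets $E^0$ (vertices, here nonempty) and $E^1$ (edges) and range and source maps $r,s:E^1\to E^0$. A path of length $n\ge 1$ is $\alpha=e_1\cdots e_n$ with $r(e_i)=s(e_{i+1})$; $s(\alpha)=s(e_1)$, $r(\alpha)=r(e_n)$; vertices are paths of length $0$. Write $v\ge w$ if there is a path from $v$ to $w$. For a unital commutative ring $R$, $L_R(E)$ is the universal $R$-algebra generated by pairwise orthogonal idempotents $\{v:v\in E^0\}$ and elements $\{e,e^*:e\in E^1\}$ subject to: $s(e)e=er(e)=e$; $r(e)e^*=e^*s(e)=e^*$; $e^*f=\delta_{e,f}r(e)$; and $v=\sum_{s(e)=v}ee^*$ whenever $0<|s^{-1}(v)|<\infty$. For a path $\alpha=e_1\cdots e_n$, $\alpha^*:=e_n^*\cdots e_1^*$, and $v^*:=v$. $L_R(E)$ is $\mathbb Z$-graded with $L_R(E)_k=\mathrm{span}_R\{\alpha\beta^*: r(\alpha)=r(\beta),\ |\alpha|-|\beta|=k\}$; a (two-sided) ideal $I$ is graded if $I=\bigoplus_k (I\cap L_R(E)_k)$. An ideal $I$ of $L_R(E)$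 is basic if $\lambda x\in I$ with $\lambda\in R\setminus\{0\}$ implies $x\in I$, whenever either $x\in E^0$ or $x=v-\sum_{i=1}^n e_ie_i^*$ with $v\in E^0$ and distinct edges $e_1,\dots,e_n\in s^{-1}(v)$. A (not necessarily unital) nonzero ring $A$ is prime if for all ideals $J_1,J_2$ of $A$ with $J_1J_2=(0)$, one has $J_1=(0)$ or $J_2=(0)$. *)

theory Defs
  imports
    "HOL-Library.Poly_Mapping"
    "HOL-Library.Countable_Set"
    "HOL-Algebra.QuotRing"
    "HOL-Algebra.Ideal_Product"
    "HOL-Algebra.Module"
    "Graph_Theory.Arc_Walk"
begin

text \<open>
  A graph \<open>E\<close> is a \<^typ>\<open>('v, 'e) pre_digraph\<close> satisfying \<^const>\<open>wf_digraph\<close>; the source and range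
  maps are \<^const>\<open>tail\<close> and \<^const>\<open>head\<close>. A path is the arc list of a \<^const>\<open>pre_digraph.awalk\<close>,
  taken together with its start vertex, which is needed for paths of length zero.

  The coefficient ring is the type \<open>'r\<close> of sort \<open>{comm_ring, comm_monoid_mult}\<close>, i.e. a commutative
  ring with unit in which, unlike in \<^class>\<open>comm_ring_1\<close>, the case \<open>0 = 1\<close> is not excluded. It is
  referred to by a variable \<open>R :: 'r itself\<close>.
\<close>


section \<open>Rings without unit\<close>

text \<open>
  The \<^const>\<open>ring\<close> and \<^const>\<open>ideal\<close> locales of HOL-Algebra assume a unit. The records and the locale
  \<^const>\<open>additive_subgroup\<close> do not depend on it; the field \<^const>\<open>one\<close> is never used below.
\<close>

definition two_sided_ideal :: "'a set \<Rightarrow> ('a, 'm) ring_scheme \<Rightarrow> bool" where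
  "two_sided_ideal I A \<longleftrightarrow> additive_subgroup I A \<and>
     (\<forall>a\<in>carrier A. \<forall>x\<in>I. a \<otimes>\<^bsub>A\<^esub> x \<in> I \<and> x \<otimes>\<^bsub>A\<^esub> a \<in> I)"

definition prime_ring :: "('a, 'm) ring_scheme \<Rightarrow> bool" where
  "prime_ring A \<longleftrightarrow> carrier A \<noteq> {\<zero>\<^bsub>A\<^esub>} \<and>
     (\<forall>J\<^sub>1 J\<^sub>2. two_sided_ideal J\<^sub>1 A \<longrightarrow> two_sided_ideal J\<^sub>2 A \<longrightarrow>
        ideal_prod A J\<^sub>1 J\<^sub>2 = {\<zero>\<^bsub>A\<^esub>} \<longrightarrow> J\<^sub>1 = {\<zero>\<^bsub>A\<^esub>} \<or> J\<^sub>2 = {\<zero>\<^bsub>A\<^esub>})"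

definition integral_domain :: "'r::{comm_ring, comm_monoid_mult} itself \<Rightarrow> bool" where
  "integral_domain R \<longleftrightarrow> (0::'r) \<noteq> 1 \<and> (\<forall>a b::'r. a * b = 0 \<longrightarrow> a = 0 \<or> b = 0)"

inductive_set lin_span :: "('r, 'a, 'm) module_scheme \<Rightarrow> 'a set \<Rightarrow> 'a set"
  for M :: "('r, 'a, 'm) module_scheme" and S :: "'a set" where
  zero: "\<zero>\<^bsub>M\<^esub> \<in> lin_span M S"
| add_smult: "x \<in> S \<Longrightarrow> y \<in> lin_span M S \<Longrightarrow> (c \<odot>\<^bsub>M\<^esub> x) \<oplus>\<^bsub>M\<^esub> y \<in> lin_span M S"


section \<open>The free algebra on vertices, edges and ghost edges\<close>

datatype ('v, 'e) generator = Vertex 'v | Edge 'e | Ghost 'e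

text \<open>
  With words forming a monoid under concatenation, multiplication on the type
  \<open>'g list \<Rightarrow>\<^sub>0 'r\<close> of finitely supported functions is the convolution product.
\<close>

instantiation list :: (type) monoid_add
begin

definition zero_list :: "'a list" where "zero_list = []"
definition plus_list :: "'a list \<Rightarrow> 'a list \<Rightarrow> 'a list" where "plus_list = (@)"

instance by standard (simp_all add: zero_list_def plus_list_def)

end

type_synonym ('v, 'e, 'r) words = "('v, 'e) generator list \<Rightarrow>\<^sub>0 'r"

definition generators :: "('v, 'e) pre_digraph \<Rightarrow> ('v, 'e) generator set" where
  "generators E = Vertex ` verts E \<union> Edge ` arcs E \<union> Ghost ` arcs E"

text \<open>Only nonempty words are allowed: this is the free algebra without adjoined unit.\<close>

definition free_algebra ::
  "'r::{comm_ring, comm_monoid_mult} itself \<Rightarrow> ('v, 'e) pre_digraph \<Rightarrow>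
    ('r, ('v, 'e, 'r) words) module" where
  "free_algebra R E =
     \<lparr> carrier = {f. \<forall>w\<in>Poly_Mapping.keys f. w \<noteq> [] \<and> set w \<subseteq> generators E},
       mult = (*), one = undefined, zero = 0, add = (+),
       smult = (\<lambda>c. Poly_Mapping.map ((*) c)) \<rparr>"

abbreviation gen :: "('v, 'e) generator \<Rightarrow> ('v, 'e, 'r::{comm_ring, comm_monoid_mult}) words" where
  "gen g \<equiv> Poly_Mapping.single [g] 1"

inductive leavitt_relation ::
  "('v, 'e) pre_digraph \<Rightarrow> ('v, 'e, 'r::{comm_ring, comm_monoid_mult}) words \<Rightarrow>
    ('v, 'e, 'r) words \<Rightarrow> bool"
  for E :: "('v, 'e) pre_digraph" where
  vertex_idem: "v \<in> verts E \<Longrightarrow>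
    leavitt_relation E (gen (Vertex v) * gen (Vertex v)) (gen (Vertex v))"
| vertex_orth: "v \<in> verts E \<Longrightarrow> w \<in> verts E \<Longrightarrow> v \<noteq> w \<Longrightarrow>
    leavitt_relation E (gen (Vertex v) * gen (Vertex w)) 0"
| source_edge: "e \<in> arcs E \<Longrightarrow>
    leavitt_relation E (gen (Vertex (tail E e)) * gen (Edge e)) (gen (Edge e))"
| edge_range: "e \<in> arcs E \<Longrightarrow>
    leavitt_relation E (gen (Edge e) * gen (Vertex (head E e))) (gen (Edge e))"
| range_ghost: "e \<in> arcs E \<Longrightarrow>
    leavitt_relation E (gen (Vertex (head E e)) * gen (Ghost e)) (gen (Ghost e))"
| ghost_source: "e \<in> arcs E \<Longrightarrow>
    leavitt_relation E (gen (Ghost e) * gen (Vertex (tail E e))) (gen (Ghost e))"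
| ghost_edge: "e \<in> arcs E \<Longrightarrow> f \<in> arcs E \<Longrightarrow>
    leavitt_relation E (gen (Ghost e) * gen (Edge f)) (if e = f then gen (Vertex (head E e)) else 0)"
| regular_vertex: "v \<in> verts E \<Longrightarrow> out_arcs E v \<noteq> {} \<Longrightarrow> finite (out_arcs E v) \<Longrightarrow>
    leavitt_relation E (gen (Vertex v)) (\<Sum>e\<in>out_arcs E v. gen (Edge e) * gen (Ghost e))"


section \<open>The Leavitt path algebra\<close>

text \<open>
  The universal algebra is the free one modulo the algebra ideal generated by the relations. Closure
  under scalars has to be required since the free algebra has no unit.
\<close>

definition leavitt_ideal ::
  "'r::{comm_ring, comm_monoid_mult} itself \<Rightarrow> ('v, 'e) pre_digraph \<Rightarrow> ('v, 'e, 'r) words set" where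
  "leavitt_ideal R E =
     \<Inter>{I. two_sided_ideal I (free_algebra R E) \<and>
          (\<forall>c. \<forall>x\<in>I. c \<odot>\<^bsub>free_algebra R E\<^esub> x \<in> I) \<and>
          (\<forall>x y. leavitt_relation E x y \<longrightarrow> x - y \<in> I)}"

definition leavitt_class ::
  "'r::{comm_ring, comm_monoid_mult} itself \<Rightarrow> ('v, 'e) pre_digraph \<Rightarrow>
    ('v, 'e, 'r) words \<Rightarrow> ('v, 'e, 'r) words set" where
  "leavitt_class R E f = leavitt_ideal R E +>\<^bsub>free_algebra R E\<^esub> f"

definition leavitt ::
  "'r::{comm_ring, comm_monoid_mult} itself \<Rightarrow> ('v, 'e) pre_digraph \<Rightarrow>
    ('r, ('v, 'e, 'r) words set) module" where
  "leavitt R E =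
     \<lparr> carrier = a_rcosets\<^bsub>free_algebra R E\<^esub> (leavitt_ideal R E),
       mult = rcoset_mult (free_algebra R E) (leavitt_ideal R E), one = undefined,
       zero = leavitt_ideal R E, add = set_add (free_algebra R E),
       smult = (\<lambda>c X. \<Union>x\<in>X. leavitt_class R E (c \<odot>\<^bsub>free_algebra R E\<^esub> x)) \<rparr>"

definition vertex ::
  "'r::{comm_ring, comm_monoid_mult} itself \<Rightarrow> ('v, 'e) pre_digraph \<Rightarrow> 'v \<Rightarrow>
    ('v, 'e, 'r) words set" where
  "vertex R E v = leavitt_class R E (gen (Vertex v))"

definition edge ::
  "'r::{comm_ring, comm_monoid_mult} itself \<Rightarrow> ('v, 'e) pre_digraph \<Rightarrow> 'e \<Rightarrow>
    ('v, 'e, 'r) words set" where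
  "edge R E e = leavitt_class R E (gen (Edge e))"

definition ghost ::
  "'r::{comm_ring, comm_monoid_mult} itself \<Rightarrow> ('v, 'e) pre_digraph \<Rightarrow> 'e \<Rightarrow>
    ('v, 'e, 'r) words set" where
  "ghost R E e = leavitt_class R E (gen (Ghost e))"


section \<open>Grading and basic ideals\<close>

definition path_word :: "'v \<Rightarrow> 'e list \<Rightarrow> ('v, 'e) generator list" where
  "path_word u p = (if p = [] then [Vertex u] else map Edge p)"

definition ghost_word :: "'v \<Rightarrow> 'e list \<Rightarrow> ('v, 'e) generator list" where
  "ghost_word u p = (if p = [] then [Vertex u] else map Ghost (rev p))"

definition path_elem ::
  "'r::{comm_ring, comm_monoid_mult} itself \<Rightarrow> ('v, 'e) pre_digraph \<Rightarrow> 'v \<Rightarrow> 'e list \<Rightarrow>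
    ('v, 'e, 'r) words set" where
  "path_elem R E u p = leavitt_class R E (Poly_Mapping.single (path_word u p) 1)"

definition ghost_elem ::
  "'r::{comm_ring, comm_monoid_mult} itself \<Rightarrow> ('v, 'e) pre_digraph \<Rightarrow> 'v \<Rightarrow> 'e list \<Rightarrow>
    ('v, 'e, 'r) words set" where
  "ghost_elem R E u p = leavitt_class R E (Poly_Mapping.single (ghost_word u p) 1)"

definition homogeneous ::
  "'r::{comm_ring, comm_monoid_mult} itself \<Rightarrow> ('v, 'e) pre_digraph \<Rightarrow> int \<Rightarrow>
    ('v, 'e, 'r) words set set" where
  "homogeneous R E k = lin_span (leavitt R E)
     {path_elem R E u p \<otimes>\<^bsub>leavitt R E\<^esub> ghost_elem R E u' q | u p u' q.
        (\<exists>w. pre_digraph.awalk E u p w \<and> pre_digraph.awalk E u' q w) \<and>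
        int (length p) - int (length q) = k}"

text \<open>Internal direct sum: existence and uniqueness of the decomposition into components in \<open>I\<close>.\<close>

definition graded_ideal ::
  "'r::{comm_ring, comm_monoid_mult} itself \<Rightarrow> ('v, 'e) pre_digraph \<Rightarrow>
    ('v, 'e, 'r) words set set \<Rightarrow> bool" where
  "graded_ideal R E I \<longleftrightarrow> two_sided_ideal I (leavitt R E) \<and>
     (\<forall>x\<in>I. \<exists>!c :: int \<Rightarrow> ('v, 'e, 'r) words set.
        (\<forall>k. c k \<in> I \<inter> homogeneous R E k) \<and>
        finite {k. c k \<noteq> \<zero>\<^bsub>leavitt R E\<^esub>} \<and>
        x = finsum (leavitt R E) c {k. c k \<noteq> \<zero>\<^bsub>leavitt R E\<^esub>})"

definition vertex_gap ::
  "'r::{comm_ring, comm_monoid_mult} itself \<Rightarrow> ('v, 'e) pre_digraph \<Rightarrow> 'v \<Rightarrow> 'e set \<Rightarrow>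
    ('v, 'e, 'r) words set" where
  "vertex_gap R E v S = vertex R E v \<ominus>\<^bsub>leavitt R E\<^esub>
     finsum (leavitt R E) (\<lambda>e. edge R E e \<otimes>\<^bsub>leavitt R E\<^esub> ghost R E e) S"

definition basic_ideal ::
  "'r::{comm_ring, comm_monoid_mult} itself \<Rightarrow> ('v, 'e) pre_digraph \<Rightarrow>
    ('v, 'e, 'r) words set set \<Rightarrow> bool" where
  "basic_ideal R E I \<longleftrightarrow> two_sided_ideal I (leavitt R E) \<and>
     (\<forall>c::'r. c \<noteq> 0 \<longrightarrow>
        (\<forall>v\<in>verts E. c \<odot>\<^bsub>leavitt R E\<^esub> vertex R E v \<in> I \<longrightarrow> vertex R E v \<in> I) \<and>
        (\<forall>v\<in>verts E. \<forall>S. finite S \<and> S \<noteq> {} \<and> S \<subseteq> out_arcs E v \<longrightarrow>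
           c \<odot>\<^bsub>leavitt R E\<^esub> vertex_gap R E v S \<in> I \<longrightarrow> vertex_gap R E v S \<in> I))"


section \<open>Condition (MT3)\<close>

definition connects_to :: "('v, 'e) pre_digraph \<Rightarrow> 'v \<Rightarrow> 'v \<Rightarrow> bool" where
  "connects_to E v w \<longleftrightarrow> (\<exists>p. pre_digraph.awalk E v p w)"

definition MT3 :: "('v, 'e) pre_digraph \<Rightarrow> bool" where
  "MT3 E \<longleftrightarrow> (\<forall>v\<in>verts E. \<forall>w\<in>verts E. \<exists>y\<in>verts E. connects_to E v y \<and> connects_to E w y)"

end

theory Submission
  imports Defs
begin

text \<open>
  Two tools carry the proof: representations, which show that certain elements are not zero, and a
  reduction, which finds a vertex near any nonzero element.

  \<^emph>\<open>Representations.\<close> Let \<open>Z\<close> be a hereditary and saturated set of vertices. Give every vertex outside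
  \<open>Z\<close> a copy of \<open>\<nat>\<close>. Unless all its outgoing edges end in \<open>Z\<close>, identify this copy with the
  disjoint union of the copies at their heads outside \<open>Z\<close>; this is possible because there are only
  countably many edges.
  Edges and ghost edges then act on \<open>R\<close>-valued functions by moving along this identification. A
  further coordinate in \<open>\<int>\<close> records the degree. Vertices in \<open>Z\<close> act as zero, whereas
  \<open>c v + t\<close> with \<open>c \<noteq> 0\<close>, \<open>v \<notin> Z\<close> and \<open>t\<close> a combination of closed paths of
  positive length at \<open>v\<close> never acts as zero, as the degree coordinate separates \<open>c v\<close> from
  \<open>t\<close> (\<open>vertex_notin_ker\<close>). For the same reason the kernel of the representation is a graded ideal,
  and over an integral domain it is basic (\<open>ker_graded\<close>, \<open>ker_basic\<close>).

  \<^emph>\<open>Reduction.\<close> Every nonzero \<open>x\<close> can be multiplied on both sides so as to become \<open>c v + t\<close> as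
  above; if \<open>x\<close> is homogeneous then \<open>t = 0\<close> (\<open>reduction\<close>). First, right multiplication by edges
  removes the ghost edges without killing \<open>x\<close>; then left multiplication by the ghost of a shortest
  path in the result turns that path into a vertex and all others into closed paths of
  positive length or zero.
  In particular an element that acts as zero for two disjoint sets \<open>Z\<close> and \<open>Z'\<close> is zero
  (\<open>disjoint_ker_inter\<close>).

  \<^emph>\<open>The equivalences.\<close> If \<open>a b = 0\<close> in \<open>R\<close>, the ideals of multiples of \<open>a\<close> and of \<open>b\<close> annihilate each
  other. If \<open>v\<close> and \<open>w\<close> have no common descendant, then \<open>w\<close> and \<open>v\<close> lie in disjoint hereditary
  saturated sets (\<open>separating_sets\<close>), and the two kernels are nonzero ideals with zero intersection.
  They contradict both primeness and the condition on graded basic ideals, so each of these implies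
  (MT3). Conversely, let \<open>R\<close> be a domain and assume (MT3). Two nonzero ideals contain elements
  \<open>c v + s\<close> and \<open>d w + t\<close>. Conjugation with paths from \<open>v\<close> and \<open>w\<close> to a common vertex \<open>y\<close> turns them
  into \<open>c y + s'\<close> and \<open>d y + t'\<close>, whose product \<open>c d y + \<dots>\<close> has the same shape and is not zero. If
  the ideals are graded and basic, they even contain \<open>v\<close> and \<open>w\<close>, and hence \<open>y\<close>.
\<close>

section \<open>The free algebra modulo the Leavitt relations\<close>

lemma poly_mapping_single_induct [case_names zero add_single]:
  fixes f :: "'a \<Rightarrow>\<^sub>0 'b::comm_monoid_add"
  assumes "P 0" "\<And>f a b. P f \<Longrightarrow> P (f + Poly_Mapping.single a b)"
  shows "P f"
proof (induction f rule: update_induct)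
  case (update f a b)
  have "Poly_Mapping.update a b f = f + Poly_Mapping.single a b"
    using update.hyps by (intro poly_mapping_eqI)
      (auto simp: lookup_update lookup_add lookup_single when_def in_keys_iff)
  then show ?case using assms(2) update.IH by simp
qed (use assms in simp)

locale leavitt_graph = wf_digraph E for E :: "('v, 'e) pre_digraph" +
  fixes R :: "'r::{comm_ring, comm_monoid_mult} itself"
  assumes countable_arcs: "countable (arcs E)"
begin

abbreviation C :: "('v, 'e, 'r) words set" where "C \<equiv> carrier (free_algebra R E)"
abbreviation N :: "('v, 'e, 'r) words set" where "N \<equiv> leavitt_ideal R E"
abbreviation sc :: "'r \<Rightarrow> ('v, 'e, 'r) words" where "sc c \<equiv> Poly_Mapping.single 0 c"
abbreviation cls :: "('v, 'e, 'r) words \<Rightarrow> ('v, 'e, 'r) words set" where "cls \<equiv> leavitt_class R E"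
abbreviation L where "L \<equiv> leavitt R E"

lemma C_iff: "f \<in> C \<longleftrightarrow> (\<forall>w\<in>Poly_Mapping.keys f. w \<noteq> [] \<and> set w \<subseteq> generators E)"
  by (simp add: free_algebra_def)

lemma free_simps [simp]:
  "x \<otimes>\<^bsub>free_algebra R E\<^esub> y = x * y" "x \<oplus>\<^bsub>free_algebra R E\<^esub> y = x + y"
  "\<zero>\<^bsub>free_algebra R E\<^esub> = 0" "c \<odot>\<^bsub>free_algebra R E\<^esub> x = sc c * x"
  by (simp_all add: free_algebra_def mult_map_scale_conv_mult)

text \<open>
  Multiplication by \<open>sc c\<close>, supported on the empty word, is scalar multiplication by \<open>c\<close>; the element
  \<open>sc c\<close> itself lies outside the algebra of nonempty words. Scalars written in this way obey the ring
  laws of the type.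
\<close>
lemma sc_commute: "f * sc c = sc c * (f :: ('v, 'e, 'r) words)"
  by (induction f rule: poly_mapping_single_induct)
    (simp_all add: distrib_left distrib_right mult_single mult.commute)

lemma sc_left_commute: "f * (sc c * g) = sc c * (f * (g :: ('v, 'e, 'r) words))"
  by (metis sc_commute mult.assoc)

lemma sc_sc: "sc c * (sc d * g) = sc (c * d) * (g :: ('v, 'e, 'r) words)"
  by (simp add: mult.assoc [symmetric] mult_single)

lemma sc_one [simp]: "sc 1 * g = (g :: ('v, 'e, 'r) words)"
  by (rule poly_mapping_eqI) (simp flip: mult_map_scale_conv_mult add: Poly_Mapping.map.rep_eq when_def)

lemma C_zero [simp]: "0 \<in> C" by (simp add: C_iff)
lemma C_add [simp, intro]: "f \<in> C \<Longrightarrow> g \<in> C \<Longrightarrow> f + g \<in> C"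
  using Poly_Mapping.keys_add [of f g] by (fastforce simp: C_iff)
lemma keys_uminus: "Poly_Mapping.keys (- f) = Poly_Mapping.keys (f :: ('v, 'e, 'r) words)"
  by (auto simp: in_keys_iff)
lemma C_uminus [simp, intro]: "f \<in> C \<Longrightarrow> - f \<in> C"
  by (simp add: C_iff keys_uminus)
lemma C_diff [simp, intro]: "f \<in> C \<Longrightarrow> g \<in> C \<Longrightarrow> f - g \<in> C"
  using C_add [of f "- g"] by simp
lemma C_mult [simp, intro]: "f \<in> C \<Longrightarrow> g \<in> C \<Longrightarrow> f * g \<in> C"
  using Poly_Mapping.keys_mult [of f g] by (fastforce simp: C_iff plus_list_def)
lemma C_sc [simp, intro]: "f \<in> C \<Longrightarrow> sc c * f \<in> C"
  using Poly_Mapping.keys_mult [of "sc c" f] by (fastforce simp: C_iff split: if_splits)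
lemma C_single [intro]: "w \<noteq> [] \<Longrightarrow> set w \<subseteq> generators E \<Longrightarrow> Poly_Mapping.single w c \<in> C"
  by (simp add: C_iff)
lemma C_sum [simp, intro]: "(\<And>i. i \<in> I \<Longrightarrow> f i \<in> C) \<Longrightarrow> sum f I \<in> C"
  by (induction I rule: infinite_finite_induct) auto

text \<open>
  This is \<^const>\<open>two_sided_ideal\<close> for the free algebra with the record operations unfolded; see
  \<open>two_sided_ideal_free\<close>.
\<close>
definition free_ideal :: "('v, 'e, 'r) words set \<Rightarrow> bool" where
  "free_ideal I \<longleftrightarrow> I \<subseteq> C \<and> 0 \<in> I \<and> (\<forall>x\<in>I. \<forall>y\<in>I. x + y \<in> I) \<and> (\<forall>x\<in>I. - x \<in> I) \<and>
     (\<forall>a\<in>C. \<forall>x\<in>I. a * x \<in> I \<and> x * a \<in> I)"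

lemma free_idealD:
  assumes "free_ideal I"
  shows "x \<in> I \<Longrightarrow> x \<in> C" "0 \<in> I" "x \<in> I \<Longrightarrow> y \<in> I \<Longrightarrow> x + y \<in> I" "x \<in> I \<Longrightarrow> - x \<in> I"
    "a \<in> C \<Longrightarrow> x \<in> I \<Longrightarrow> a * x \<in> I" "a \<in> C \<Longrightarrow> x \<in> I \<Longrightarrow> x * a \<in> I"
  using assms by (auto simp: free_ideal_def)

lemma free_neg:
  assumes "x \<in> C"
  shows "inv\<^bsub>add_monoid (free_algebra R E)\<^esub> x = - x"
proof -
  have "y = - x" if "x + y = 0" for y
    using that by (simp add: add_eq_0_iff)
  then show ?thesis
    using assms by (auto simp: m_inv_def intro!: the_equality)
qed

lemma two_sided_ideal_free: "two_sided_ideal I (free_algebra R E) \<longleftrightarrow> free_ideal I"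
  unfolding two_sided_ideal_def free_ideal_def additive_subgroup_def subgroup_def
  using free_neg by (auto simp: subset_iff)

lemma leavitt_relation_C:
  assumes "leavitt_relation E x y"
  shows "x - (y :: ('v, 'e, 'r) words) \<in> C"
proof -
  have [simp]: "gen (Vertex v) \<in> C" if "v \<in> verts E" for v
    using that by (auto simp: generators_def)
  have [simp]: "gen (Edge e) \<in> C" "gen (Ghost e) \<in> C" if "e \<in> arcs E" for e
    using that by (auto simp: generators_def)
  from assms show ?thesis
    by cases (auto intro!: C_diff C_mult C_sum)
qed

lemma free_ideal_C: "free_ideal C"
  by (auto simp: free_ideal_def)

lemma N_least:
  assumes "free_ideal I" "\<And>c x. x \<in> I \<Longrightarrow> sc c * x \<in> I" "\<And>x y. leavitt_relation E x y \<Longrightarrow> x - y \<in> I"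
  shows "N \<subseteq> I"
  unfolding leavitt_ideal_def using assms by (auto simp: two_sided_ideal_free)

lemma N_subset_C: "N \<subseteq> C"
  by (rule N_least) (auto simp: free_ideal_C leavitt_relation_C)

lemma free_ideal_N: "free_ideal N"
  using N_subset_C unfolding leavitt_ideal_def two_sided_ideal_free
  unfolding free_ideal_def by simp

lemma N_in_C [simp, intro]: "x \<in> N \<Longrightarrow> x \<in> C" using N_subset_C by auto
lemma N_zero [simp]: "0 \<in> N" using free_ideal_N by (simp add: free_ideal_def)
lemma N_add [simp, intro]: "x \<in> N \<Longrightarrow> y \<in> N \<Longrightarrow> x + y \<in> N" using free_ideal_N by (simp add: free_ideal_def)
lemma N_uminus [simp, intro]: "x \<in> N \<Longrightarrow> - x \<in> N" using free_ideal_N by (simp add: free_ideal_def)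
lemma N_diff [simp, intro]: "x \<in> N \<Longrightarrow> y \<in> N \<Longrightarrow> x - y \<in> N" using N_add [of x "- y"] by simp
lemma N_mult_left [simp, intro]: "x \<in> N \<Longrightarrow> a \<in> C \<Longrightarrow> a * x \<in> N" using free_ideal_N by (simp add: free_ideal_def)
lemma N_mult_right [simp, intro]: "x \<in> N \<Longrightarrow> a \<in> C \<Longrightarrow> x * a \<in> N" using free_ideal_N by (simp add: free_ideal_def)
lemma N_sc [simp, intro]: "x \<in> N \<Longrightarrow> sc c * x \<in> N" unfolding leavitt_ideal_def by simp
lemma N_relation: "leavitt_relation E x y \<Longrightarrow> x - y \<in> N" unfolding leavitt_ideal_def by simp

text \<open>
  Computations in the quotient are carried out with representatives. These belong to a type of class
  \<^class>\<open>ring\<close>, whereas the quotient is a ring record without unit.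
\<close>
definition eqv :: "('v, 'e, 'r) words \<Rightarrow> ('v, 'e, 'r) words \<Rightarrow> bool" (infix \<open>\<approx>\<close> 50) where
  "x \<approx> y \<longleftrightarrow> x - y \<in> N"

lemma eqv_refl [simp, intro]: "x \<approx> x" by (simp add: eqv_def)
lemma eqv_sym: "x \<approx> y \<Longrightarrow> y \<approx> x" using N_uminus [of "x - y"] by (simp add: eqv_def)
lemma eqv_trans [trans]: "x \<approx> y \<Longrightarrow> y \<approx> z \<Longrightarrow> x \<approx> z" using N_add [of "x - y" "y - z"] by (simp add: eqv_def)
lemma eqv_zero [simp]: "x \<approx> 0 \<longleftrightarrow> x \<in> N" by (simp add: eqv_def)
lemma eqv_N: "x \<approx> y \<Longrightarrow> x \<in> N \<longleftrightarrow> y \<in> N"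
  by (metis eqv_zero eqv_sym eqv_trans)
lemma eqv_C: "x \<approx> y \<Longrightarrow> x \<in> C \<longleftrightarrow> y \<in> C"
  using C_add [of "x - y" y] C_diff [of x "x - y"] by (auto simp: eqv_def)
lemma eqv_add: "x \<approx> x' \<Longrightarrow> y \<approx> y' \<Longrightarrow> x + y \<approx> x' + y'"
  unfolding eqv_def by (metis N_add add_diff_add)
lemma eqv_diff: "x \<approx> x' \<Longrightarrow> y \<approx> y' \<Longrightarrow> x - y \<approx> x' - y'"
  using eqv_add [of x x' "-y" "-y'"] N_uminus [of "y - y'"] by (simp add: eqv_def)
lemma eqv_mult_left: "x \<approx> y \<Longrightarrow> a \<in> C \<Longrightarrow> a * x \<approx> a * y"
  unfolding eqv_def by (metis N_mult_left right_diff_distrib)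
lemma eqv_mult_right: "x \<approx> y \<Longrightarrow> a \<in> C \<Longrightarrow> x * a \<approx> y * a"
  unfolding eqv_def by (metis N_mult_right left_diff_distrib)
lemma eqv_mult: "x \<approx> x' \<Longrightarrow> y \<approx> y' \<Longrightarrow> x \<in> C \<Longrightarrow> y' \<in> C \<Longrightarrow> x * y \<approx> x' * y'"
  by (meson eqv_mult_left eqv_mult_right eqv_trans)
lemma eqv_sc: "x \<approx> y \<Longrightarrow> sc c * x \<approx> sc c * y"
  unfolding eqv_def by (metis N_sc right_diff_distrib)
lemma eqv_sum: "(\<And>i. i \<in> I \<Longrightarrow> f i \<approx> g i) \<Longrightarrow> sum f I \<approx> sum g I"
  by (induction I rule: infinite_finite_induct) (auto intro: eqv_add)

section \<open>The Leavitt path algebra as a quotient\<close>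

lemma cls_alt: "cls f = {g. g \<approx> f}"
  by (auto simp: leavitt_class_def a_r_coset_defs eqv_def intro!: bexI [of _ "_ - f"])

lemma eqv_class_nonempty: "{g. g \<approx> f} \<noteq> {}"
  using eqv_refl by blast

lemma cls_eq_iff: "cls f = cls g \<longleftrightarrow> f \<approx> g"
  unfolding cls_alt using eqv_refl eqv_sym eqv_trans by blast

lemma L_carrier: "carrier L = cls ` C"
  by (auto simp: leavitt_def A_RCOSETS_defs leavitt_class_def a_r_coset_defs)

lemma L_zero: "\<zero>\<^bsub>L\<^esub> = cls 0"
  by (auto simp: leavitt_def cls_alt)

lemma L_add [simp]: "cls f \<oplus>\<^bsub>L\<^esub> cls g = cls (f + g)"
proof -
  have "\<exists>a b. a \<approx> f \<and> b \<approx> g \<and> x = a + b" if "x \<approx> f + g" for x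
    using that by (intro exI [of _ "x - g"] exI [of _ g]) (auto simp: eqv_def algebra_simps)
  then show ?thesis
    by (auto simp: leavitt_def set_add_defs cls_alt intro: eqv_add)
qed

lemma L_mult [simp]: "f \<in> C \<Longrightarrow> g \<in> C \<Longrightarrow> cls f \<otimes>\<^bsub>L\<^esub> cls g = cls (f * g)"
proof -
  assume fg: "f \<in> C" "g \<in> C"
  have *: "cls (a * b) = cls (f * g)" if "a \<in> {a. a \<approx> f}" "b \<in> {b. b \<approx> g}" for a b
    using that fg eqv_C by (auto simp: cls_eq_iff intro!: eqv_mult)
  have "(\<Union>a\<in>{a. a \<approx> f}. \<Union>b\<in>{b. b \<approx> g}. cls (a * b)) = (\<Union>a\<in>{a. a \<approx> f}. \<Union>b\<in>{b. b \<approx> g}. cls (f * g))"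
    by (intro SUP_cong refl *)
  also have "\<dots> = cls (f * g)" by (simp only: UN_constant eqv_class_nonempty if_False)
  finally have "(\<Union>a\<in>cls f. \<Union>b\<in>cls g. cls (a * b)) = cls (f * g)" by (simp only: cls_alt [of f] cls_alt [of g])
  then show ?thesis
    unfolding leavitt_class_def by (simp add: leavitt_def rcoset_mult_def)
qed

lemma L_smult [simp]: "c \<odot>\<^bsub>L\<^esub> cls f = cls (sc c * f)"
proof -
  have "c \<odot>\<^bsub>L\<^esub> cls f = (\<Union>x\<in>{x. x \<approx> f}. cls (sc c * x))"
    by (simp add: leavitt_def cls_alt)
  also have "\<dots> = (\<Union>x\<in>{x. x \<approx> f}. cls (sc c * f))"
    by (intro SUP_cong refl) (auto simp: cls_eq_iff eqv_sc)
  also have "\<dots> = cls (sc c * f)" by (simp only: UN_constant eqv_class_nonempty if_False)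
  finally show ?thesis .
qed

lemma L_abelian: "abelian_group L"
proof (rule abelian_groupI)
  fix x assume "x \<in> carrier L"
  then obtain f where "f \<in> C" "x = cls f" by (auto simp: L_carrier)
  then show "\<exists>y\<in>carrier L. y \<oplus>\<^bsub>L\<^esub> x = \<zero>\<^bsub>L\<^esub>"
    by (auto simp: L_carrier L_zero intro!: bexI [of _ "- f"])
next
  show "\<zero>\<^bsub>L\<^esub> \<in> carrier L" by (simp add: L_carrier L_zero)
next
  fix x y assume "x \<in> carrier L" "y \<in> carrier L"
  then obtain f g where fg: "f \<in> C" "x = cls f" "g \<in> C" "y = cls g" by (auto simp: L_carrier)
  show "x \<oplus>\<^bsub>L\<^esub> y \<in> carrier L" using fg by (simp add: L_carrier)
  show "x \<oplus>\<^bsub>L\<^esub> y = y \<oplus>\<^bsub>L\<^esub> x" using fg by (simp add: add.commute)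
  show "\<zero>\<^bsub>L\<^esub> \<oplus>\<^bsub>L\<^esub> x = x" using fg by (simp add: L_zero)
  fix z assume "z \<in> carrier L"
  then obtain h where h: "z = cls h" by (auto simp: L_carrier)
  show "x \<oplus>\<^bsub>L\<^esub> y \<oplus>\<^bsub>L\<^esub> z = x \<oplus>\<^bsub>L\<^esub> (y \<oplus>\<^bsub>L\<^esub> z)" using fg h by (simp add: add.assoc)
qed

sublocale L: abelian_group L by (rule L_abelian)

lemma L_uminus: "f \<in> C \<Longrightarrow> \<ominus>\<^bsub>L\<^esub> cls f = cls (- f)"
  by (rule L.minus_equality) (auto simp: L_carrier L_zero)

lemma L_diff: "f \<in> C \<Longrightarrow> g \<in> C \<Longrightarrow> cls f \<ominus>\<^bsub>L\<^esub> cls g = cls (f - g)"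
  by (simp add: a_minus_def L_uminus)

lemma L_finsum:
  assumes "finite A" "\<And>i. i \<in> A \<Longrightarrow> f i \<in> C"
  shows "finsum L (\<lambda>i. cls (f i)) A = cls (sum f A)"
  using assms
proof (induction A rule: finite_induct)
  case (insert a A)
  have "finsum L (\<lambda>i. cls (f i)) (insert a A) = cls (f a) \<oplus>\<^bsub>L\<^esub> finsum L (\<lambda>i. cls (f i)) A"
    by (rule L.finsum_insert) (use insert in \<open>auto simp: L_carrier\<close>)
  then show ?case using insert by simp
qed (simp add: L_zero)

text \<open>
  Ideals of the quotient correspond to the ideals of the free algebra that contain \<open>N\<close>.
\<close>
definition preimage :: "('v, 'e, 'r) words set set \<Rightarrow> ('v, 'e, 'r) words set" where
  "preimage I = {f \<in> C. cls f \<in> I}"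

lemma preimage_ideal:
  assumes "two_sided_ideal I L"
  shows "free_ideal (preimage I)" "N \<subseteq> preimage I" "I = cls ` preimage I"
proof -
  from assms have sub: "I \<subseteq> carrier L" and z: "\<zero>\<^bsub>L\<^esub> \<in> I" and a: "\<And>x y. x \<in> I \<Longrightarrow> y \<in> I \<Longrightarrow> x \<oplus>\<^bsub>L\<^esub> y \<in> I"
    and m: "\<And>x. x \<in> I \<Longrightarrow> \<ominus>\<^bsub>L\<^esub> x \<in> I"
    and mu: "\<And>a x. a \<in> carrier L \<Longrightarrow> x \<in> I \<Longrightarrow> a \<otimes>\<^bsub>L\<^esub> x \<in> I \<and> x \<otimes>\<^bsub>L\<^esub> a \<in> I"
    unfolding two_sided_ideal_def additive_subgroup_def subgroup_def by (auto simp: a_inv_def)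
  show "I = cls ` preimage I" using sub by (auto simp: preimage_def L_carrier)
  show "N \<subseteq> preimage I"
  proof
    fix x assume "x \<in> N"
    then have "cls x = cls 0" by (simp add: cls_eq_iff)
    then show "x \<in> preimage I" using z \<open>x \<in> N\<close> by (simp add: preimage_def L_zero)
  qed
  have "x + y \<in> preimage I" if "x \<in> preimage I" "y \<in> preimage I" for x y
    using a [of "cls x" "cls y"] that by (simp add: preimage_def)
  moreover have "- x \<in> preimage I" if "x \<in> preimage I" for x
    using m [of "cls x"] that by (simp add: preimage_def L_uminus)
  moreover have "f * x \<in> preimage I \<and> x * f \<in> preimage I" if "f \<in> C" "x \<in> preimage I" for f x
    using mu [of "cls f" "cls x"] that by (simp add: preimage_def L_carrier)
  moreover have "preimage I \<subseteq> C" "0 \<in> preimage I" using z by (auto simp: preimage_def L_zero)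
  ultimately show "free_ideal (preimage I)" unfolding free_ideal_def by blast
qed

lemma image_ideal:
  assumes "free_ideal I"
  shows "two_sided_ideal (cls ` I) L"
proof -
  have *: "I \<subseteq> C" "0 \<in> I" "\<And>x y. x \<in> I \<Longrightarrow> y \<in> I \<Longrightarrow> x + y \<in> I" "\<And>x. x \<in> I \<Longrightarrow> - x \<in> I"
     "\<And>a x. a \<in> C \<Longrightarrow> x \<in> I \<Longrightarrow> a * x \<in> I \<and> x * a \<in> I"
    using assms [unfolded free_ideal_def] by simp_all
  have neg: "\<ominus>\<^bsub>L\<^esub> x \<in> cls ` I" if x: "x \<in> cls ` I" for x
  proof -
    obtain g where "x = cls g" "g \<in> I" using x by blast
    then show ?thesis using *(4) [of g] L_uminus [of g] *(1) by auto
  qed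
  have add: "x \<oplus>\<^bsub>L\<^esub> y \<in> cls ` I" if xy: "x \<in> cls ` I" "y \<in> cls ` I" for x y
  proof -
    obtain f g where "x = cls f" "f \<in> I" "y = cls g" "g \<in> I" using xy by blast
    then show ?thesis using *(3) [of f g] by auto
  qed
  have "subgroup (cls ` I) (add_monoid L)"
  proof
    show "cls ` I \<subseteq> carrier (add_monoid L)" using *(1) by (auto simp: L_carrier)
    show "\<one>\<^bsub>add_monoid L\<^esub> \<in> cls ` I" using *(2) by (auto simp: L_zero)
  qed (use add neg in \<open>simp_all add: a_inv_def\<close>)
  moreover have "a \<otimes>\<^bsub>L\<^esub> x \<in> cls ` I \<and> x \<otimes>\<^bsub>L\<^esub> a \<in> cls ` I" if ax: "a \<in> carrier L" "x \<in> cls ` I" for a x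
  proof -
    obtain f g where "a = cls f" "f \<in> C" "x = cls g" "g \<in> I" using ax by (auto simp: L_carrier)
    then show ?thesis using *(5) [of f g] *(1) by auto
  qed
  ultimately show ?thesis
    unfolding two_sided_ideal_def additive_subgroup_def by blast
qed

lemma image_eq_iff:
  assumes "N \<subseteq> I" "free_ideal I"
  shows "cls f \<in> cls ` I \<longleftrightarrow> f \<in> I"
proof
  assume "cls f \<in> cls ` I"
  then obtain g where g: "g \<in> I" "f \<approx> g" by (auto simp: cls_eq_iff)
  then have "f - g \<in> I" using assms(1) by (auto simp: eqv_def)
  then have "(f - g) + g \<in> I" using assms(2) g(1) by (intro free_idealD(3))
  then show "f \<in> I" by simp
qed simp

lemma ideal_nonzero:
  assumes "two_sided_ideal I L"
  shows "I \<noteq> {\<zero>\<^bsub>L\<^esub>} \<longleftrightarrow> (\<exists>f\<in>preimage I. f \<notin> N)"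
proof -
  have "cls 0 \<in> I" using free_idealD(2) [OF preimage_ideal(1) [OF assms]] by (simp add: preimage_def)
  moreover have "x = cls 0" if "x \<in> I" "preimage I \<subseteq> N" for x
  proof -
    have "x \<in> cls ` preimage I" using preimage_ideal(3) [OF assms] \<open>x \<in> I\<close> by simp
    then obtain f where f: "x = cls f" "f \<in> preimage I" by blast
    then have "f \<in> N" using that by blast
    then show ?thesis by (simp add: f cls_eq_iff)
  qed
  moreover have "f \<in> N" if "f \<in> preimage I" "I = {cls 0}" for f
  proof -
    have "cls f \<in> {cls 0}" using that by (simp add: preimage_def)
    then show ?thesis by (simp add: cls_eq_iff)
  qed
  ultimately show ?thesis unfolding L_zero by blast
qed

section \<open>Representations attached to hereditary saturated sets\<close>

definition hereditary_saturated :: "'v set \<Rightarrow> bool" where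
  "hereditary_saturated Z \<longleftrightarrow> (\<forall>e\<in>arcs E. tail E e \<in> Z \<longrightarrow> head E e \<in> Z) \<and>
     (\<forall>v\<in>verts E. out_arcs E v \<noteq> {} \<longrightarrow> finite (out_arcs E v) \<longrightarrow>
        (\<forall>e\<in>out_arcs E v. head E e \<in> Z) \<longrightarrow> v \<in> Z)"

text \<open>
  The copy of \<open>\<nat>\<close> at \<open>v\<close> is split among the edges leaving \<open>v\<close> with head outside \<open>Z\<close> by the bijections
  \<^const>\<open>to_nat_on\<close> and \<^const>\<open>from_nat_into\<close> between \<open>branches Z v\<close> and \<open>\<nat>\<close>, which exist as soon as
  there is one such edge.
\<close>
definition branches :: "'v set \<Rightarrow> 'v \<Rightarrow> ('e \<times> nat) set" where
  "branches Z v = {e \<in> out_arcs E v. head E e \<notin> Z} \<times> UNIV"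

lemma countable_branches [simp]: "countable (branches Z v)"
  unfolding branches_def
  by (intro countable_SIGMA countable_subset [OF _ countable_arcs]) auto

lemma infinite_branches: "branches Z v \<noteq> {} \<Longrightarrow> infinite (branches Z v)"
  by (auto simp: branches_def finite_cartesian_product_iff)

text \<open>
  The functions live on triples of a vertex, a point of its copy of \<open>\<nat>\<close> and a degree. The ghost of \<open>e\<close>
  restricts a function to the branch of \<open>e\<close>, and \<open>e\<close> extends it by zero from there. No support
  condition is imposed on the functions, as every generator reads off at most one value.
\<close>
fun gen_act :: "'v set \<Rightarrow> ('v, 'e) generator \<Rightarrow> ('v \<Rightarrow> nat \<Rightarrow> int \<Rightarrow> 'r) \<Rightarrow> 'v \<Rightarrow> nat \<Rightarrow> int \<Rightarrow> 'r" where
  "gen_act Z (Vertex v) \<phi> = (\<lambda>u m k. if u = v \<and> v \<notin> Z then \<phi> u m k else 0)"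
| "gen_act Z (Edge e) \<phi> = (\<lambda>u m k. if u = tail E e \<and> head E e \<notin> Z \<and> fst (from_nat_into (branches Z u) m) = e
     then \<phi> (head E e) (snd (from_nat_into (branches Z u) m)) (k - 1) else 0)"
| "gen_act Z (Ghost e) \<phi> = (\<lambda>u m k. if u = head E e \<and> head E e \<notin> Z
     then \<phi> (tail E e) (to_nat_on (branches Z (tail E e)) (e, m)) (k + 1) else 0)"

definition word_act where "word_act Z = foldr (gen_act Z)"

definition act :: "'v set \<Rightarrow> ('v, 'e, 'r) words \<Rightarrow> ('v \<Rightarrow> nat \<Rightarrow> int \<Rightarrow> 'r) \<Rightarrow> 'v \<Rightarrow> nat \<Rightarrow> int \<Rightarrow> 'r" where
  "act Z f \<phi> u m k = (\<Sum>w\<in>Poly_Mapping.keys f. Poly_Mapping.lookup f w * word_act Z w \<phi> u m k)"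

lemma word_act_simps: "word_act Z [] \<phi> = \<phi>" "word_act Z (g # w) \<phi> = gen_act Z g (word_act Z w \<phi>)"
  "word_act Z (w @ w') \<phi> = word_act Z w (word_act Z w' \<phi>)"
  by (simp_all add: word_act_def)

lemma word_act_add: "word_act Z w (\<lambda>u m k. \<phi> u m k + \<psi> u m k) u m k = word_act Z w \<phi> u m k + word_act Z w \<psi> u m k"
proof (induction w arbitrary: u m k)
  case (Cons g w)
  have "word_act Z w (\<lambda>u m k. \<phi> u m k + \<psi> u m k) = (\<lambda>u m k. word_act Z w \<phi> u m k + word_act Z w \<psi> u m k)"
    by (intro ext Cons.IH)
  then show ?case by (cases g) (auto simp: word_act_simps)
qed (simp add: word_act_simps)

lemma word_act_scale: "word_act Z w (\<lambda>u m k. c * \<phi> u m k) u m k = c * word_act Z w \<phi> u m k"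
proof (induction w arbitrary: u m k)
  case (Cons g w)
  have "word_act Z w (\<lambda>u m k. c * \<phi> u m k) = (\<lambda>u m k. c * word_act Z w \<phi> u m k)"
    by (intro ext Cons.IH)
  then show ?case by (cases g) (auto simp: word_act_simps)
qed (simp add: word_act_simps)

lemma word_act_zero: "word_act Z w (\<lambda>u m k. 0) u m k = 0"
  using word_act_scale [of Z w 0 "\<lambda>u m k. 0"] by simp

lemma act_add: "act Z (f + g) \<phi> u m k = act Z f \<phi> u m k + act Z g \<phi> u m k"
  unfolding act_def
  by (rule setsum_keys_plus_distrib) (simp_all add: distrib_right)

lemma act_zero [simp]: "act Z 0 \<phi> u m k = 0"
  by (simp add: act_def)

lemma act_single: "act Z (Poly_Mapping.single w c) \<phi> u m k = c * word_act Z w \<phi> u m k"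
  by (simp add: act_def)

lemma act_uminus: "act Z (- f) \<phi> u m k = - act Z f \<phi> u m k"
  using act_add [of Z f "- f" \<phi> u m k] by (simp add: eq_neg_iff_add_eq_0 add.commute)

lemma act_diff: "act Z (f - g) \<phi> u m k = act Z f \<phi> u m k - act Z g \<phi> u m k"
  using act_add [of Z f "- g"] by (simp add: act_uminus)

lemma act_sum: "act Z (sum f I) \<phi> u m k = (\<Sum>i\<in>I. act Z (f i) \<phi> u m k)"
  by (induction I rule: infinite_finite_induct) (simp_all add: act_add)

lemma act_arg_add: "act Z f (\<lambda>u m k. \<phi> u m k + \<psi> u m k) u m k = act Z f \<phi> u m k + act Z f \<psi> u m k"
  by (simp add: act_def word_act_add distrib_left sum.distrib)

lemma act_mult_single: "act Z (Poly_Mapping.single w c * g) \<phi> u m k = c * word_act Z w (act Z g \<phi>) u m k"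
proof (induction g arbitrary: u m k rule: poly_mapping_single_induct)
  case zero
  have "act Z 0 \<phi> = (\<lambda>u m k. 0)" by (intro ext) simp
  then show ?case by (simp add: word_act_zero)
next
  case (add_single g w' d)
  have "act Z (g + Poly_Mapping.single w' d) \<phi> = (\<lambda>u m k. act Z g \<phi> u m k + d * word_act Z w' \<phi> u m k)"
    by (intro ext) (simp add: act_add act_single)
  then show ?case using add_single
    by (simp add: act_add act_single distrib_left mult_single plus_list_def word_act_simps word_act_add word_act_scale mult.assoc)
qed

lemma act_mult: "act Z (f * g) \<phi> u m k = act Z f (act Z g \<phi>) u m k"
  by (induction f rule: poly_mapping_single_induct)
    (simp_all add: act_add act_single distrib_right act_mult_single)

lemma act_gen: "act Z (gen g) \<phi> = gen_act Z g \<phi>"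
  by (intro ext) (simp add: act_single word_act_simps)

lemma act_gen_mult: "act Z (gen g * f) \<phi> = gen_act Z g (act Z f \<phi>)"
  by (intro ext) (simp add: act_mult act_gen)

lemma act_sc: "act Z (sc c * f) \<phi> u m k = c * act Z f \<phi> u m k"
  by (simp add: act_mult_single word_act_simps zero_list_def)

lemma decode_encode [simp]:
  "e \<in> arcs E \<Longrightarrow> head E e \<notin> Z \<Longrightarrow> from_nat_into (branches Z (tail E e)) (to_nat_on (branches Z (tail E e)) (e, m)) = (e, m)"
  by (rule from_nat_into_to_nat_on [OF countable_branches]) (simp add: branches_def)

text \<open>
  Saturation of \<open>Z\<close> is what makes the relation at a regular vertex hold: such a vertex outside \<open>Z\<close> has a
  branch, hence every point of its copy of \<open>\<nat>\<close> lies in exactly one branch.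
\<close>
lemma act_regular:
  assumes Z: "hereditary_saturated Z" and v: "v \<in> verts E" "out_arcs E v \<noteq> {}" "finite (out_arcs E v)"
  shows "act Z (\<Sum>e\<in>out_arcs E v. gen (Edge e) * gen (Ghost e)) \<phi> u m k = gen_act Z (Vertex v) \<phi> u m k"
proof -
  let ?d = "from_nat_into (branches Z v) m"
  have eg: "act Z (gen (Edge e) * gen (Ghost e)) \<phi> u m k =
      (if u = v \<and> head E e \<notin> Z \<and> fst ?d = e then \<phi> v (to_nat_on (branches Z v) ?d) k else 0)"
    if "e \<in> out_arcs E v" for e
    using that by (cases ?d) (auto simp: act_gen_mult act_gen)
  show ?thesis
  proof (cases "u = v \<and> v \<notin> Z")
    case True
    then have "branches Z v \<noteq> {}" using Z v by (auto simp: hereditary_saturated_def branches_def)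
    then have "?d \<in> branches Z v" "to_nat_on (branches Z v) ?d = m"
      by (simp_all add: from_nat_into infinite_branches)
    then have d: "fst ?d \<in> out_arcs E v" "head E (fst ?d) \<notin> Z" by (auto simp: branches_def)
    have "act Z (\<Sum>e\<in>out_arcs E v. gen (Edge e) * gen (Ghost e)) \<phi> u m k =
        (\<Sum>e\<in>out_arcs E v. if e = fst ?d then \<phi> v m k else 0)"
      unfolding act_sum
    proof (rule sum.cong [OF refl])
      fix e assume "e \<in> out_arcs E v"
      from eg [OF this] show "act Z (gen (Edge e) * gen (Ghost e)) \<phi> u m k = (if e = fst ?d then \<phi> v m k else 0)"
        using True d \<open>to_nat_on _ _ = m\<close> by auto
    qed
    also have "\<dots> = \<phi> v m k" using d v by simp
    finally show ?thesis using True by simp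
  next
    case False
    have "head E e \<in> Z" if "v \<in> Z" "e \<in> out_arcs E v" for e
      using that Z by (auto simp: hereditary_saturated_def)
    then have "act Z (gen (Edge e) * gen (Ghost e)) \<phi> u m k = 0" if "e \<in> out_arcs E v" for e
      using that False by (auto simp only: eg split: if_splits)
    then show ?thesis using False by (simp only: act_sum sum.neutral) auto
  qed
qed

lemma act_relation:
  assumes Z: "hereditary_saturated Z" and "leavitt_relation E x y"
  shows "act Z x \<phi> u m k = act Z y \<phi> u m k"
proof -
  have her: "tail E e \<notin> Z" if "e \<in> arcs E" "head E e \<notin> Z" for e
    using that Z by (auto simp: hereditary_saturated_def)
  show ?thesis
    using assms(2)
  proof cases
    case (regular_vertex v)
    show ?thesis
      by (simp only: regular_vertex(1,2) act_gen act_regular [OF Z regular_vertex(3-5)])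
  next
    case (ghost_edge e f)
    then show ?thesis using her by (auto simp: act_gen_mult act_gen fun_eq_iff)
  qed (use her in \<open>auto simp: act_gen_mult act_gen\<close>)
qed

definition ker :: "'v set \<Rightarrow> ('v, 'e, 'r) words set" where
  "ker Z = {f \<in> C. \<forall>\<phi> u m k. act Z f \<phi> u m k = 0}"

lemma kerD: "f \<in> ker Z \<Longrightarrow> act Z f \<phi> u m k = 0" by (simp add: ker_def)

lemma ker_ideal: "free_ideal (ker Z)"
proof -
  have "act Z (a * x) \<phi> u m k = 0" if "x \<in> ker Z" for a x \<phi> u m k
  proof -
    have "act Z x \<phi> = (\<lambda>u m k. 0)" using that by (intro ext) (rule kerD)
    then show ?thesis unfolding act_mult by (simp add: act_def word_act_zero)
  qed
  moreover have "act Z (x * a) \<phi> u m k = 0" if "x \<in> ker Z" for a x \<phi> u m k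
    unfolding act_mult using that by (rule kerD)
  ultimately show ?thesis
    by (auto simp: free_ideal_def ker_def act_add act_uminus)
qed

lemma N_subset_ker: "hereditary_saturated Z \<Longrightarrow> N \<subseteq> ker Z"
  by (rule N_least [OF ker_ideal])
    (auto simp: ker_def act_sc act_diff act_relation leavitt_relation_C)

section \<open>Degrees\<close>

fun gen_degree :: "('v, 'e) generator \<Rightarrow> int" where
  "gen_degree (Vertex v) = 0" | "gen_degree (Edge e) = 1" | "gen_degree (Ghost e) = - 1"

definition word_degree :: "('v, 'e) generator list \<Rightarrow> int" where
  "word_degree w = sum_list (map gen_degree w)"

lemma word_act_degree: "(\<And>u m. \<phi> u m (k - word_degree w) = 0) \<Longrightarrow> word_act Z w \<phi> u m k = 0"
proof (induction w arbitrary: u m k)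
  case (Cons g w)
  have "word_act Z w \<phi> u m (k - gen_degree g) = 0" for u m
    using Cons.prems by (intro Cons.IH) (simp add: word_degree_def algebra_simps)
  then show ?case by (cases g) (simp_all add: word_act_simps)
qed (simp add: word_act_simps word_degree_def)

text \<open>
  An operator that raises the last coordinate of the support by exactly \<open>d\<close>.
\<close>
definition shifts :: "'v set \<Rightarrow> int \<Rightarrow> ('v, 'e, 'r) words \<Rightarrow> bool" where
  "shifts Z d f \<longleftrightarrow> (\<forall>\<phi> u m k. (\<forall>u m. \<phi> u m (k - d) = 0) \<longrightarrow> act Z f \<phi> u m k = 0)"

text \<open>
  Restricting the argument to degree \<open>k - d\<close> and evaluating in degree \<open>k\<close> isolates the summand of
  degree \<open>d\<close>.
\<close>
lemma ker_components:
  assumes f: "\<And>k. k \<in> A \<Longrightarrow> shifts Z k (f k)" "\<And>k. k \<in> A \<Longrightarrow> f k \<in> C" and A: "finite A"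
    and ker: "(\<Sum>k\<in>A. f k) \<in> ker Z" and d: "d \<in> A"
  shows "f d \<in> ker Z"
proof -
  have "act Z (f d) \<phi> u m k = 0" for \<phi> u m k
  proof -
    \<comment> \<open>the only part of \<open>\<phi>\<close> that \<open>f d\<close> moves to degree \<open>k\<close>\<close>
    define \<psi> where "\<psi> = (\<lambda>u m j. if j = k - d then \<phi> u m j else 0)"
    have "act Z (f d) (\<lambda>u m j. \<phi> u m j - \<psi> u m j) u m k = 0"
      using f(1) [OF d] by (auto simp: shifts_def \<psi>_def)
    moreover have "act Z (f d) \<phi> u m k = act Z (f d) (\<lambda>u m j. \<phi> u m j - \<psi> u m j) u m k + act Z (f d) \<psi> u m k"
      by (simp flip: act_arg_add)
    moreover have "act Z (f d) \<psi> u m k = (\<Sum>i\<in>A. act Z (f i) \<psi> u m k)"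
    proof -
      have "act Z (f i) \<psi> u m k = 0" if "i \<in> A - {d}" for i
        using f(1) [of i] that by (auto simp: shifts_def \<psi>_def)
      then show ?thesis using A d by (simp add: sum.remove)
    qed
    moreover have "\<dots> = 0" using kerD [OF ker] by (simp add: act_sum)
    ultimately show ?thesis by simp
  qed
  then show ?thesis using f d by (simp add: ker_def)
qed

section \<open>Linear spans modulo the relations\<close>

text \<open>
  Every span contains \<open>N\<close>, so that membership can be decided by computations modulo \<open>N\<close>.
\<close>
inductive_set span :: "('v, 'e, 'r) words set \<Rightarrow> ('v, 'e, 'r) words set"
  for S :: "('v, 'e, 'r) words set" where
  base: "x \<in> N \<Longrightarrow> x \<in> span S"
| step: "s \<in> S \<Longrightarrow> y \<in> span S \<Longrightarrow> sc c * s + y \<in> span S"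

lemma span_eqv:
  assumes "x \<in> span S" "x \<approx> y"
  shows "y \<in> span S"
  using assms
proof (induction arbitrary: y)
  case (base x)
  then show ?case using eqv_N by (blast intro: span.base)
next
  case (step s z c)
  then have "z \<approx> y - sc c * s" by (simp add: eqv_def algebra_simps)
  then have "sc c * s + (y - sc c * s) \<in> span S" using step by (intro span.step)
  then show ?case by simp
qed

lemma span_eqv_sym: "x \<approx> y \<Longrightarrow> y \<in> span S \<Longrightarrow> x \<in> span S"
  using span_eqv eqv_sym by metis

lemma span_add [intro]: "x \<in> span S \<Longrightarrow> y \<in> span S \<Longrightarrow> x + y \<in> span S"
proof (induction rule: span.induct)
  case (base x)
  then show ?case by (auto intro: span_eqv simp: eqv_def)
qed (auto simp: add.assoc intro: span.step)

lemma span_generator [intro]: "s \<in> S \<Longrightarrow> s \<in> span S"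
  using span.step [of s S 0 1] by (simp add: span.base)

lemma span_sc: "x \<in> span S \<Longrightarrow> sc c * x \<in> span S"
  by (induction rule: span.induct) (auto simp: distrib_left sc_sc intro: span.intros)

lemma span_sum: "(\<And>i. i \<in> I \<Longrightarrow> f i \<in> span S) \<Longrightarrow> sum f I \<in> span S"
  by (induction I rule: infinite_finite_induct) (auto intro: span.base)

lemma span_subset: "x \<in> span S \<Longrightarrow> (\<And>s. s \<in> S \<Longrightarrow> s \<in> span T) \<Longrightarrow> x \<in> span T"
  by (induction rule: span.induct) (auto intro: span.base span_sc)

lemma span_C: "x \<in> span S \<Longrightarrow> S \<subseteq> C \<Longrightarrow> x \<in> C"
  by (induction rule: span.induct) auto

lemma span_mult_left:
  assumes "x \<in> span S" "a \<in> C" "\<And>s. s \<in> S \<Longrightarrow> a * s \<in> span T"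
  shows "a * x \<in> span T"
  using assms(1)
  by (induction rule: span.induct)
    (auto simp: distrib_left sc_left_commute intro: span.base span_sc assms)

lemma span_mult_right:
  assumes "x \<in> span S" "a \<in> C" "\<And>s. s \<in> S \<Longrightarrow> s * a \<in> span T"
  shows "x * a \<in> span T"
  using assms(1)
  by (induction rule: span.induct)
    (auto simp: distrib_right mult.assoc intro: span.base span_sc assms)

section \<open>Paths and ghost paths\<close>

text \<open>
  Vertices, edges and ghost edges are the paths and ghost paths of length at most one, so that all
  relations can be phrased in terms of \<open>P\<close> and \<open>G\<close>.
\<close>
abbreviation P :: "'v \<Rightarrow> 'e list \<Rightarrow> ('v, 'e, 'r) words" where
  "P u p \<equiv> Poly_Mapping.single (path_word u p) 1"
abbreviation G :: "'v \<Rightarrow> 'e list \<Rightarrow> ('v, 'e, 'r) words" where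
  "G u p \<equiv> Poly_Mapping.single (ghost_word u p) 1"

lemma single_words_mult: "Poly_Mapping.single w 1 * Poly_Mapping.single w' (1::'r) = Poly_Mapping.single (w @ w') 1"
  by (simp add: mult_single plus_list_def)

lemma P_C [simp, intro]: "awalk u p v \<Longrightarrow> P u p \<in> C"
  by (rule C_single) (auto simp: path_word_def generators_def awalk_def)

lemma G_C [simp, intro]: "awalk u p v \<Longrightarrow> G u p \<in> C"
  by (rule C_single) (auto simp: ghost_word_def generators_def awalk_def)

lemma P_Nil_C [simp, intro]: "v \<in> verts E \<Longrightarrow> P v [] \<in> C"
  by (rule P_C [of _ _ v]) (simp add: awalk_Nil_iff)
lemma P_edge_C [simp, intro]: "e \<in> arcs E \<Longrightarrow> P v [e] \<in> C"
  by (rule C_single) (auto simp: path_word_def generators_def)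
lemma G_edge_C [simp, intro]: "e \<in> arcs E \<Longrightarrow> G v [e] \<in> C"
  by (rule C_single) (auto simp: ghost_word_def generators_def)

lemma G_Nil: "G v [] = P v []" by (simp add: path_word_def ghost_word_def)

lemma vertex_mult:
  assumes "v \<in> verts E"
  shows "P v [] * P v [] \<approx> P v []" "w \<in> verts E \<Longrightarrow> v \<noteq> w \<Longrightarrow> P v [] * P w [] \<in> N"
  using N_relation [OF vertex_idem [of v E]] N_relation [OF vertex_orth [of v E w]] assms
  by (simp_all add: path_word_def eqv_def)

lemma edge_mult:
  assumes "e \<in> arcs E"
  shows "P (tail E e) [] * P u [e] \<approx> P u [e]" "P u [e] * P (head E e) [] \<approx> P u [e]"
    "P (head E e) [] * G u [e] \<approx> G u [e]" "G u [e] * P (tail E e) [] \<approx> G u [e]"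
    "G u [e] * P u' [e] \<approx> P (head E e) []"
    "f \<in> arcs E \<Longrightarrow> e \<noteq> f \<Longrightarrow> G u [e] * P u' [f] \<in> N"
  using N_relation [OF source_edge [of e E]] N_relation [OF edge_range [of e E]]
    N_relation [OF range_ghost [of e E]] N_relation [OF ghost_source [of e E]]
    N_relation [OF ghost_edge [of e E e]] N_relation [OF ghost_edge [of e E f]] assms
  by (simp_all add: path_word_def ghost_word_def eqv_def)

lemma P_Cons:
  assumes "awalk u (e # p) w"
  shows "P u (e # p) \<approx> P u [e] * P (head E e) p"
proof (cases p)
  case Nil
  then show ?thesis using edge_mult(2) [of e u] assms by (auto simp: awalk_Cons_iff intro: eqv_sym)
qed (simp add: single_words_mult, simp add: path_word_def)

lemma G_Cons:
  assumes "awalk u (e # p) w"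
  shows "G u (e # p) \<approx> G (head E e) p * G u [e]"
proof (cases p)
  case Nil
  then show ?thesis using edge_mult(3) [of e u] assms by (auto simp: awalk_Cons_iff G_Nil intro: eqv_sym)
qed (simp add: single_words_mult, simp add: ghost_word_def)

lemma P_append:
  assumes "awalk u p v" "awalk v q w"
  shows "P u p * P v q \<approx> P u (p @ q)"
  using assms(1)
proof (induction p arbitrary: u)
  case Nil
  then have [simp]: "u = v" "v \<in> verts E" by (auto simp: awalk_Nil_iff)
  show ?case
  proof (cases q)
    case Nil
    then show ?thesis using vertex_mult by simp
  next
    case (Cons e q')
    then have e: "e \<in> arcs E" "v = tail E e" "awalk (head E e) q' w" using assms(2) by (auto simp: awalk_Cons_iff)
    have "P v [] * P v q \<approx> P v [] * (P v [e] * P (head E e) q')"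
      using assms(2) Cons by (auto intro!: eqv_mult_left P_Cons)
    also have "\<dots> = P v [] * P v [e] * P (head E e) q'" by (simp add: mult.assoc)
    also have "\<dots> \<approx> P v [e] * P (head E e) q'"
      using edge_mult(1) [of e v] e by (auto intro!: eqv_mult_right)
    also have "\<dots> \<approx> P v q" using assms(2) Cons by (auto intro!: eqv_sym [OF P_Cons])
    finally show ?thesis by simp
  qed
next
  case (Cons e p)
  then have e: "e \<in> arcs E" "u = tail E e" "awalk (head E e) p v" by (auto simp: awalk_Cons_iff)
  have "P u (e # p) * P v q \<approx> P u [e] * P (head E e) p * P v q"
    using Cons.prems assms(2) by (auto intro!: eqv_mult_right P_Cons)
  also have "\<dots> = P u [e] * (P (head E e) p * P v q)" by (simp add: mult.assoc)
  also have "\<dots> \<approx> P u [e] * P (head E e) (p @ q)" using Cons.IH e by (intro eqv_mult_left) auto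
  also have "\<dots> \<approx> P u ((e # p) @ q)"
    using e assms(2) by (auto intro!: eqv_sym [OF P_Cons [of _ _ _ w]] simp: awalk_Cons_iff)
  finally show ?case .
qed

lemma G_append:
  assumes "awalk u p v" "awalk v q w"
  shows "G v q * G u p \<approx> G u (p @ q)"
  using assms(1)
proof (induction p arbitrary: u)
  case Nil
  then have [simp]: "u = v" "v \<in> verts E" by (auto simp: awalk_Nil_iff)
  show ?case
  proof (cases q)
    case Nil
    then show ?thesis using vertex_mult by (simp add: G_Nil)
  next
    case (Cons e q')
    then have e: "e \<in> arcs E" "v = tail E e" "awalk (head E e) q' w" using assms(2) by (auto simp: awalk_Cons_iff)
    have "G v q * P v [] \<approx> G (head E e) q' * G v [e] * P v []"
      using assms(2) Cons by (auto intro!: eqv_mult_right G_Cons)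
    also have "\<dots> = G (head E e) q' * (G v [e] * P v [])" by (simp add: mult.assoc)
    also have "\<dots> \<approx> G (head E e) q' * G v [e]"
      using edge_mult(4) [of e v] e by (auto intro!: eqv_mult_left)
    also have "\<dots> \<approx> G v q" using assms(2) Cons by (auto intro!: eqv_sym [OF G_Cons])
    finally show ?thesis by (simp add: G_Nil)
  qed
next
  case (Cons e p)
  then have e: "e \<in> arcs E" "u = tail E e" "awalk (head E e) p v" by (auto simp: awalk_Cons_iff)
  have "G v q * G u (e # p) \<approx> G v q * (G (head E e) p * G u [e])"
    using Cons.prems assms(2) by (auto intro!: eqv_mult_left G_Cons)
  also have "\<dots> = G v q * G (head E e) p * G u [e]" by (simp add: mult.assoc)
  also have "\<dots> \<approx> G (head E e) (p @ q) * G u [e]" using Cons.IH e by (intro eqv_mult_right) auto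
  also have "\<dots> \<approx> G u ((e # p) @ q)"
    using e assms(2) by (auto intro!: eqv_sym [OF G_Cons [of _ _ _ w]] simp: awalk_Cons_iff)
  finally show ?case .
qed

lemma awalk_Nil [simp]: "v \<in> verts E \<Longrightarrow> awalk v [] v" by (simp add: awalk_Nil_iff)

lemma P_vertex: "awalk u p w \<Longrightarrow> P u p * P w [] \<approx> P u p"
  using P_append [of u p w "[]" w] by (auto dest: awalk_last_in_verts)
lemma vertex_P: "awalk u p w \<Longrightarrow> P u [] * P u p \<approx> P u p"
  using P_append [of u "[]" u p w] by (auto dest: awalk_hd_in_verts)
lemma G_vertex: "awalk u p w \<Longrightarrow> G u p * P u [] \<approx> G u p"
  using G_append [of u "[]" u p w] by (auto simp: G_Nil dest: awalk_hd_in_verts)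
lemma vertex_G: "awalk u p w \<Longrightarrow> P w [] * G u p \<approx> G u p"
  using G_append [of u p w "[]" w] by (auto simp: G_Nil dest: awalk_last_in_verts)

text \<open>
  Every path or ghost path has vertices as one-sided units, and distinct vertices are orthogonal.
\<close>
lemma mult_zero_by_units:
  assumes "x * a \<approx> x" "a' * b \<approx> b" "a * a' \<in> N" "x \<in> C" "b \<in> C" "a \<in> C" "a' \<in> C"
  shows "x * b \<in> N"
proof -
  have "x * b \<approx> x * a * (a' * b)" using assms by (intro eqv_mult eqv_sym [OF assms(1)] eqv_sym [OF assms(2)]) auto
  also have "x * a * (a' * b) = x * (a * a') * b" by (simp add: mult.assoc)
  finally show ?thesis using assms eqv_N by auto
qed

lemma GP_prefix:
  assumes "awalk u p v" "awalk v t w"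
  shows "G u p * P u (p @ t) \<approx> P v t"
  using assms(1)
proof (induction p arbitrary: u)
  case Nil
  then show ?case using vertex_P assms(2) by (auto simp: awalk_Nil_iff G_Nil)
next
  case (Cons e p)
  then have e: "e \<in> arcs E" "u = tail E e" "awalk (head E e) p v" by (auto simp: awalk_Cons_iff)
  then have pt: "awalk (head E e) (p @ t) w" "awalk u (e # p @ t) w" using assms(2) by (auto simp: awalk_Cons_iff)
  have "G u (e # p) * P u (e # p @ t) \<approx> (G (head E e) p * G u [e]) * (P u [e] * P (head E e) (p @ t))"
    using Cons.prems e pt by (intro eqv_mult G_Cons P_Cons) auto
  also have "\<dots> = G (head E e) p * (G u [e] * P u [e] * P (head E e) (p @ t))" by (simp add: mult.assoc)
  also have "\<dots> \<approx> G (head E e) p * (P (head E e) [] * P (head E e) (p @ t))"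
    using e pt edge_mult(5) by (intro eqv_mult_left eqv_mult_right) auto
  also have "\<dots> \<approx> G (head E e) p * P (head E e) (p @ t)"
    using e pt by (auto intro!: eqv_mult_left vertex_P)
  also have "\<dots> \<approx> P v t" using Cons.IH e by simp
  finally show ?case by simp
qed

text \<open>
  A ghost path annihilates every path that is at least as long and does not extend it: the cancellation
  of edges meets two distinct edges or two distinct start vertices before the ghost path is used up.
\<close>
lemma GP_orthogonal:
  assumes "awalk u p v" "awalk u' q w" "length p \<le> length q" "\<not> (u = u' \<and> (\<exists>t. q = p @ t))"
  shows "G u p * P u' q \<in> N"
  using assms
proof (induction p arbitrary: u u' q)
  case Nil
  then have "u \<noteq> u'" "u = v" "v \<in> verts E" "u' \<in> verts E" by (auto simp: awalk_Nil_iff dest: awalk_hd_in_verts)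
  then have "P u [] * P u' q \<in> N"
    using Nil(2) by (intro mult_zero_by_units [OF vertex_mult(1) vertex_P vertex_mult(2)]) auto
  then show ?case by (simp add: G_Nil)
next
  case (Cons e p)
  then obtain f q' where q: "q = f # q'" by (cases q) auto
  have e: "e \<in> arcs E" "u = tail E e" "awalk (head E e) p v"
    and f: "f \<in> arcs E" "u' = tail E f" "awalk (head E f) q' w"
    using Cons.prems q by (auto simp: awalk_Cons_iff)
  have "G u (e # p) * P u' q \<approx> (G (head E e) p * G u [e]) * (P u' [f] * P (head E f) q')"
    unfolding q using Cons.prems e f q by (intro eqv_mult G_Cons P_Cons) auto
  also have "\<dots> = G (head E e) p * (G u [e] * P u' [f] * P (head E f) q')" by (simp add: mult.assoc)
  finally have *: "G u (e # p) * P u' q \<in> N \<longleftrightarrow> G (head E e) p * (G u [e] * P u' [f] * P (head E f) q') \<in> N"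
    by (rule eqv_N)
  show ?case
  proof (cases "e = f")
    case True
    have "G (head E e) p * (G u [e] * P u' [f] * P (head E f) q') \<approx> G (head E e) p * (P (head E e) [] * P (head E e) q')"
      unfolding True using e f True edge_mult(5) by (intro eqv_mult_left eqv_mult_right) auto
    also have "\<dots> \<approx> G (head E e) p * P (head E e) q'"
      using e f True by (auto intro!: eqv_mult_left vertex_P)
    finally have "G (head E e) p * (G u [e] * P u' [f] * P (head E f) q') \<in> N \<longleftrightarrow> G (head E e) p * P (head E e) q' \<in> N"
      by (rule eqv_N)
    moreover have "G (head E e) p * P (head E e) q' \<in> N"
      using Cons.prems e f True q by (intro Cons.IH) auto
    ultimately show ?thesis using * by blast
  next
    case False
    then show ?thesis unfolding * using e f by (intro N_mult_left [OF N_mult_right [OF edge_mult(6)]]) auto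
  qed
qed

section \<open>Monomials span the algebra\<close>

definition monomials :: "int set \<Rightarrow> ('v, 'e, 'r) words set" where
  "monomials D = {P u p * G v q | u p v q. (\<exists>w. awalk u p w \<and> awalk v q w) \<and> int (length p) - int (length q) \<in> D}"

text \<open>
  The bound on the number of ghost edges is the induction measure of the reduction.
\<close>
definition monomials_to :: "nat \<Rightarrow> int set \<Rightarrow> 'v \<Rightarrow> ('v, 'e, 'r) words set" where
  "monomials_to n D v = {P u p * G v q | u p q. (\<exists>w. awalk u p w \<and> awalk v q w) \<and>
     int (length p) - int (length q) \<in> D \<and> length q \<le> n}"

definition real_paths :: "int set \<Rightarrow> 'v \<Rightarrow> ('v, 'e, 'r) words set" where
  "real_paths D v = {P u p | u p. awalk u p v \<and> int (length p) \<in> D}"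

text \<open>
  The lengths are restricted to differences of elements of \<open>D\<close>. For a homogeneous element \<open>D\<close> is a
  singleton, the only difference is \<open>0\<close>, and no closed path of positive length remains.
\<close>
definition closed_paths :: "int set \<Rightarrow> 'v \<Rightarrow> ('v, 'e, 'r) words set" where
  "closed_paths D v = {P v p | p. awalk v p v \<and> p \<noteq> [] \<and> (\<exists>d\<in>D. \<exists>d'\<in>D. int (length p) = d - d')}"

lemma path_sets_in_C: "monomials D \<subseteq> C" "monomials_to n D v \<subseteq> C" "real_paths D v \<subseteq> C" "closed_paths D v \<subseteq> C"
  by (auto simp: monomials_def monomials_to_def real_paths_def closed_paths_def)

lemmas span_sets_C [simp, intro] = span_C [OF _ path_sets_in_C(1)] span_C [OF _ path_sets_in_C(2)]
  span_C [OF _ path_sets_in_C(3)] span_C [OF _ path_sets_in_C(4)]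

lemma monomials_I: "awalk u p w \<Longrightarrow> awalk v q w \<Longrightarrow> int (length p) - int (length q) \<in> D \<Longrightarrow> P u p * G v q \<in> monomials D"
  unfolding monomials_def mem_Collect_eq by (intro exI conjI) (rule refl, assumption+)

lemma monomials_mono: "D \<subseteq> D' \<Longrightarrow> monomials D \<subseteq> monomials D'"
  unfolding monomials_def by blast

lemma generator_mult_monomial:
  assumes "g \<in> generators E" "s \<in> monomials {k}"
  shows "gen g * s \<in> span (monomials {k + gen_degree g})"
proof -
  obtain u p v q w where s: "s = P u p * G v q" and w: "awalk u p w" "awalk v q w"
    and k: "int (length p) - int (length q) = k"
    using assms(2) by (auto simp: monomials_def)
  show ?thesis
  proof (cases g)
    case (Vertex x)
    then have x: "x \<in> verts E" "gen g = P x []" using assms(1) by (auto simp: generators_def path_word_def)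
    show ?thesis
    proof (cases "x = u")
      case True
      have "s \<approx> P x [] * s" unfolding s True mult.assoc [symmetric]
        using w by (auto intro!: eqv_mult_right eqv_sym [OF vertex_P])
      then show ?thesis using assms(2) Vertex x by (auto intro: span_eqv)
    next
      case False
      have "P x [] * P u p \<in> N"
        using False w x awalk_hd_in_verts [OF w(1)]
        by (intro mult_zero_by_units [OF vertex_mult(1) vertex_P vertex_mult(2)]) auto
      then show ?thesis unfolding s x mult.assoc [symmetric] using w by (auto intro!: span.base)
    qed
  next
    case (Edge e)
    then have x: "e \<in> arcs E" "gen g = P (tail E e) [e]" using assms(1) by (auto simp: generators_def path_word_def)
    show ?thesis
    proof (cases "head E e = u")
      case True
      have "P (tail E e) (e # p) * G v q \<approx> gen g * s" unfolding s x mult.assoc [symmetric]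
        using w True x by (auto intro!: eqv_mult_right P_Cons [of _ _ _ w, simplified True] simp: awalk_Cons_iff)
      moreover have "P (tail E e) (e # p) * G v q \<in> monomials {k + gen_degree g}"
        using w True x k Edge by (intro monomials_I [of _ _ w]) (auto simp: awalk_Cons_iff)
      ultimately show ?thesis by (blast intro: span_eqv)
    next
      case False
      have "P (tail E e) [e] * P u p \<in> N"
        using False w x awalk_hd_in_verts [OF w(1)]
        by (intro mult_zero_by_units [OF edge_mult(2) vertex_P vertex_mult(2)]) auto
      then show ?thesis unfolding s x mult.assoc [symmetric] using w by (auto intro!: span.base)
    qed
  next
    case (Ghost e)
    then have x: "e \<in> arcs E" "gen g = G (tail E e) [e]" using assms(1) by (auto simp: generators_def ghost_word_def)
    have we: "awalk (tail E e) [e] (head E e)" using x by (simp add: arc_implies_awalk)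
    show ?thesis
    proof (cases p)
      case Nil
      then have [simp]: "w = u" "u \<in> verts E" using w by (auto simp: awalk_Nil_iff)
      have gs: "gen g * s \<approx> G (tail E e) [e] * G v q"
        unfolding s x Nil using w x by (auto intro!: eqv_mult_left vertex_G)
      show ?thesis
      proof (cases "u = tail E e")
        case True
        have "G (tail E e) [e] * G v q \<approx> G v (q @ [e])" using w we True by (auto intro!: G_append)
        moreover have "P (head E e) [] * G v (q @ [e]) \<approx> G v (q @ [e])"
          using w we True by (intro vertex_G) auto
        moreover have "P (head E e) [] * G v (q @ [e]) \<in> monomials {k + gen_degree g}"
          using w True x k Ghost Nil we by (intro monomials_I [of _ _ "head E e"]) auto
        ultimately show ?thesis using gs by (meson eqv_sym eqv_trans span_eqv span_generator)
      next
        case False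
        then have "G (tail E e) [e] * G v q \<in> N"
          using False w x
          by (intro mult_zero_by_units [OF edge_mult(4) vertex_G vertex_mult(2)]) auto
        then show ?thesis using gs eqv_N by (auto intro!: span.base)
      qed
    next
      case (Cons f p')
      then have f: "f \<in> arcs E" "u = tail E f" "awalk (head E f) p' w" using w by (auto simp: awalk_Cons_iff)
      show ?thesis
      proof (cases "e = f")
        case True
        have "G (tail E e) [e] * P u p \<approx> P (head E e) p'"
          using GP_prefix [OF we f(3) [folded True]] f True Cons by simp
        then have "gen g * s \<approx> P (head E e) p' * G v q"
          unfolding s x mult.assoc [symmetric] using w by (auto intro!: eqv_mult_right)
        moreover have "P (head E e) p' * G v q \<in> monomials {k + gen_degree g}"
          using w f True x k Ghost Cons by (intro monomials_I [of _ _ w]) auto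
        ultimately show ?thesis by (blast intro: span_eqv eqv_sym)
      next
        case False
        then have "G (tail E e) [e] * P u p \<in> N" using w Cons by (intro GP_orthogonal [OF we w(1)]) auto
        then show ?thesis unfolding s x mult.assoc [symmetric] using w by (auto intro!: span.base)
      qed
    qed
  qed
qed

lemma word_span:
  assumes "w \<noteq> []" "set w \<subseteq> generators E"
  shows "Poly_Mapping.single w 1 \<in> span (monomials {word_degree w})"
  using assms
proof (induction w rule: list_nonempty_induct)
  case (single g)
  show ?case
  proof (cases g)
    case (Vertex v)
    then have "v \<in> verts E" using single by (auto simp: generators_def)
    then have "P v [] * G v [] \<in> span (monomials {word_degree [g]})" "P v [] * G v [] \<approx> gen g"
      using Vertex monomials_I [of v "[]" v v "[]" "{0}"] vertex_mult(1)
      by (auto simp: word_degree_def G_Nil path_word_def)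
    then show ?thesis by (rule span_eqv)
  next
    case (Edge e)
    then have e: "e \<in> arcs E" using single by (auto simp: generators_def)
    have "P (tail E e) [e] * G (head E e) [] \<in> span (monomials {word_degree [g]})"
      using Edge e by (intro span_generator monomials_I [of _ _ "head E e"]) (auto simp: word_degree_def arc_implies_awalk)
    moreover have "P (tail E e) [e] * G (head E e) [] \<approx> gen g"
      using edge_mult(2) [OF e] Edge by (simp add: G_Nil) (simp add: path_word_def)
    ultimately show ?thesis by (rule span_eqv)
  next
    case (Ghost e)
    then have e: "e \<in> arcs E" using single by (auto simp: generators_def)
    have "P (head E e) [] * G (tail E e) [e] \<in> span (monomials {word_degree [g]})"
      using Ghost e by (intro span_generator monomials_I [of _ _ "head E e"]) (auto simp: word_degree_def arc_implies_awalk)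
    moreover have "P (head E e) [] * G (tail E e) [e] \<approx> gen g"
      using edge_mult(3) [OF e] Ghost by (simp add: ghost_word_def)
    ultimately show ?thesis by (rule span_eqv)
  qed
next
  case (cons g w)
  have "gen g * Poly_Mapping.single w 1 \<in> span (monomials {word_degree (g # w)})"
  proof (rule span_mult_left)
    show "Poly_Mapping.single w 1 \<in> span (monomials {word_degree w})" using cons by simp
    show "gen g \<in> C" using cons by auto
    fix s assume "s \<in> monomials {word_degree w}"
    then show "gen g * s \<in> span (monomials {word_degree (g # w)})"
      using generator_mult_monomial [of g s "word_degree w"] cons by (simp add: word_degree_def add.commute)
  qed
  then show ?case by (simp add: single_words_mult)
qed

lemma C_span: "f \<in> C \<Longrightarrow> f \<in> span (monomials UNIV)"
proof -
  assume f: "f \<in> C"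
  have "f = (\<Sum>w\<in>Poly_Mapping.keys f. sc (Poly_Mapping.lookup f w) * Poly_Mapping.single w 1)"
    by (rule poly_mapping_eqI)
      (simp add: lookup_sum mult_single zero_list_def plus_list_def lookup_single when_def in_keys_iff)
  also have "\<dots> \<in> span (monomials UNIV)"
  proof (intro span_sum span_sc)
    fix w assume "w \<in> Poly_Mapping.keys f"
    then have "Poly_Mapping.single w 1 \<in> span (monomials {word_degree w})" using f by (intro word_span) (auto simp: C_iff)
    then show "Poly_Mapping.single w 1 \<in> span (monomials UNIV)"
      by (rule span_subset) (use monomials_mono [OF subset_UNIV] in blast)
  qed
  finally show ?thesis .
qed

lemma monomial_shifts:
  assumes Z: "hereditary_saturated Z" and "x \<in> span (monomials {k})"
  shows "shifts Z k x"
  using assms(2)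
proof (induction rule: span.induct)
  case (base x)
  then have "x \<in> ker Z" using N_subset_ker [OF Z] by auto
  then show ?case by (simp add: shifts_def kerD)
next
  case (step s y c)
  from step(1) obtain u p v q where s: "s = Poly_Mapping.single (path_word u p @ ghost_word v q) 1"
    and k: "k = int (length p) - int (length q)"
    unfolding monomials_def single_words_mult by auto
  have "word_degree (path_word u p @ ghost_word v q) = k"
    unfolding k by (auto simp: path_word_def ghost_word_def word_degree_def comp_def sum_list_triv simp flip: rev_map)
  then have "shifts Z k s" unfolding shifts_def s act_single using word_act_degree by force
  then show ?case using step(3) by (simp add: shifts_def act_add act_sc)
qed

text \<open>
  Apply the element to the indicator function of degree \<open>0\<close> and evaluate in degree \<open>0\<close>: closed paths of
  positive length move the support away, and only the coefficient of the vertex is left.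
\<close>
lemma vertex_notin_ker:
  assumes Z: "hereditary_saturated Z" and v: "v \<notin> Z" and c: "c \<noteq> 0" and t: "t \<in> span (closed_paths D v)"
  shows "sc c * P v [] + t \<notin> ker Z"
proof
  define \<phi> where "\<phi> = (\<lambda>(u::'v) (m::nat) (k::int). if k = 0 then 1 else (0::'r))"
  have "act Z t \<phi> u m 0 = 0" for u m
    using t
  proof (induction rule: span.induct)
    case (base x)
    then show ?case using N_subset_ker [OF Z] kerD by auto
  next
    case (step s y d)
    then obtain p where s: "s = P v p" "p \<noteq> []" by (auto simp: closed_paths_def)
    have "word_degree (path_word v p) = int (length p)"
      using s by (auto simp: path_word_def word_degree_def comp_def sum_list_triv)
    then have "word_act Z (path_word v p) \<phi> u m 0 = 0"
      using s by (intro word_act_degree) (simp add: \<phi>_def)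
    then show ?case using step s by (simp add: act_add act_sc act_single)
  qed
  then have "act Z (sc c * P v [] + t) \<phi> v 0 0 = c"
    using v by (simp add: act_add act_sc act_gen path_word_def \<phi>_def)
  moreover assume "sc c * P v [] + t \<in> ker Z"
  ultimately show False using c kerD by metis
qed

lemma hereditary_saturated_empty: "hereditary_saturated {}"
  by (auto simp: hereditary_saturated_def)

lemma vertex_notin_N:
  assumes "c \<noteq> 0" "t \<in> span (closed_paths D v)"
  shows "sc c * P v [] + t \<notin> N"
  using vertex_notin_ker [OF hereditary_saturated_empty _ assms] N_subset_ker [OF hereditary_saturated_empty] by auto

section \<open>Local units\<close>

text \<open>
  The algebra need not have a unit. For elements that are reproduced by a finite partial sum of an orthogonal
  family of idempotents, the family is a substitute: such an element is zero if all its products with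
  members of the family are (\<open>absorbed_nonzero\<close>). The families used are the vertices and, for the part
  with ghost edges, the products of an edge with its ghost.
\<close>
definition absorbed :: "'i set \<Rightarrow> ('i \<Rightarrow> ('v, 'e, 'r) words) \<Rightarrow> ('v, 'e, 'r) words \<Rightarrow> bool" where
  "absorbed I a x \<longleftrightarrow> x \<in> C \<and> (\<exists>F. finite F \<and> F \<subseteq> I \<and> x * sum a F \<approx> x)"

definition orthogonal_family :: "'i set \<Rightarrow> ('i \<Rightarrow> ('v, 'e, 'r) words) \<Rightarrow> bool" where
  "orthogonal_family I a \<longleftrightarrow> (\<forall>i\<in>I. a i \<in> C \<and> a i * a i \<approx> a i) \<and> (\<forall>i\<in>I. \<forall>j\<in>I. i \<noteq> j \<longrightarrow> a i * a j \<in> N)"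

lemma absorbed_enlarge:
  assumes a: "orthogonal_family I a" and x: "x \<in> C" "x * sum a F \<approx> x"
    and F: "finite F'" "F \<subseteq> F'" "F' \<subseteq> I"
  shows "x * sum a F' \<approx> x"
proof -
  have C: "sum a F \<in> C" "sum a F' \<in> C"
    using a F by (auto simp: orthogonal_family_def intro!: C_sum)
  have "a i * sum a F' \<approx> a i" if "i \<in> F" for i
  proof -
    have "a i * sum a F' = (\<Sum>j\<in>F'. a i * a j)" by (simp add: sum_distrib_left)
    also have "\<dots> \<approx> (\<Sum>j\<in>F'. if j = i then a i else 0)"
    proof (rule eqv_sum)
      fix j assume "j \<in> F'"
      then show "a i * a j \<approx> (if j = i then a i else 0)"
        using a that F unfolding orthogonal_family_def by (cases "j = i") (simp_all add: subset_iff)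
    qed
    also have "\<dots> = a i" using F that by auto
    finally show ?thesis .
  qed
  then have "(\<Sum>i\<in>F. a i * sum a F') \<approx> sum a F" by (rule eqv_sum)
  then have ff: "sum a F * sum a F' \<approx> sum a F" by (simp add: sum_distrib_right)
  have "x * sum a F' \<approx> x * sum a F * sum a F'"
    using x C by (intro eqv_mult_right eqv_sym [OF x(2)]) auto
  also have "\<dots> = x * (sum a F * sum a F')" by (simp add: mult.assoc)
  also have "\<dots> \<approx> x * sum a F" using x ff by (intro eqv_mult_left)
  also have "\<dots> \<approx> x" by (rule x)
  finally show ?thesis .
qed

lemma absorbed_span:
  assumes a: "orthogonal_family I a" and x: "x \<in> span S" and S: "\<And>s. s \<in> S \<Longrightarrow> absorbed I a s"
  shows "absorbed I a x"
  using x
proof (induction rule: span.induct)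
  case (base x)
  then show ?case unfolding absorbed_def by (intro conjI exI [of _ "{}"]) (auto intro: eqv_sym)
next
  case (step s y c)
  then obtain F F' where F: "finite F" "F \<subseteq> I" "s * sum a F \<approx> s" "finite F'" "F' \<subseteq> I" "y * sum a F' \<approx> y"
    and C: "s \<in> C" "y \<in> C"
    using S unfolding absorbed_def by meson
  have "s * sum a (F \<union> F') \<approx> s" "y * sum a (F \<union> F') \<approx> y"
    using F C by (auto intro: absorbed_enlarge [OF a])
  then have "sc c * (s * sum a (F \<union> F')) + y * sum a (F \<union> F') \<approx> sc c * s + y"
    by (intro eqv_add eqv_sc)
  then have "(sc c * s + y) * sum a (F \<union> F') \<approx> sc c * s + y"
    by (simp add: distrib_right mult.assoc)
  then show ?case using F C unfolding absorbed_def by (intro conjI exI [of _ "F \<union> F'"]) auto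
qed

lemma absorbed_nonzero:
  assumes "absorbed I a x" "x \<notin> N"
  shows "\<exists>i\<in>I. x * a i \<notin> N"
proof (rule ccontr)
  assume not: "\<not> ?thesis"
  obtain F where F: "F \<subseteq> I" "x * sum a F \<approx> x" using assms(1) unfolding absorbed_def by blast
  have "(\<Sum>i\<in>F. x * a i) \<approx> (\<Sum>i\<in>F. 0)"
    using not F(1) by (intro eqv_sum) auto
  then have "x * sum a F \<in> N" by (simp add: sum_distrib_left)
  then show False using F(2) assms(2) eqv_N by blast
qed

lemma orthogonal_vertices: "orthogonal_family (verts E) (\<lambda>v. P v [])"
  unfolding orthogonal_family_def using vertex_mult by auto

lemma orthogonal_edges: "orthogonal_family (out_arcs E v) (\<lambda>e. P v [e] * G v [e])"
proof -
  have "P v [e] * G v [e] * (P v [e] * G v [e]) \<approx> P v [e] * G v [e]" if "e \<in> out_arcs E v" for e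
  proof -
    have e: "e \<in> arcs E" "awalk v [e] (head E e)" using that by (auto simp: awalk_Cons_iff)
    have "P v [e] * G v [e] * (P v [e] * G v [e]) = P v [e] * (G v [e] * P v [e]) * G v [e]"
      by (simp add: mult.assoc)
    also have "\<dots> \<approx> P v [e] * P (head E e) [] * G v [e]"
      using e by (intro eqv_mult_right eqv_mult_left edge_mult(5)) auto
    also have "\<dots> \<approx> P v [e] * G v [e]"
      using e by (intro eqv_mult_right edge_mult(2)) auto
    finally show ?thesis .
  qed
  moreover have "P v [e] * G v [e] * (P v [f] * G v [f]) \<in> N" if "e \<in> out_arcs E v" "f \<in> out_arcs E v" "e \<noteq> f" for e f
  proof -
    have "P v [e] * ((G v [e] * P v [f]) * G v [f]) \<in> N"
      using that by (intro N_mult_left [OF N_mult_right [OF edge_mult(6)]]) auto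
    then show ?thesis by (simp add: mult.assoc)
  qed
  ultimately show ?thesis by (auto simp: orthogonal_family_def)
qed

lemma vertex_absorbs_monomial:
  assumes "awalk u p w" "awalk v q w"
  shows "P u p * G v q * P v [] \<approx> P u p * G v q"
  unfolding mult.assoc using assms by (auto intro!: eqv_mult_left G_vertex)

lemma other_vertex_kills_monomial:
  assumes "awalk u p w" "awalk v q w" "x \<in> verts E" "x \<noteq> v"
  shows "P u p * G v q * P x [] \<in> N"
proof -
  have v: "v \<in> verts E" using assms by auto
  have "G v q * P x [] \<in> N"
    using assms v by (intro mult_zero_by_units [OF G_vertex vertex_mult(1) vertex_mult(2)]) auto
  then show ?thesis unfolding mult.assoc using assms by auto
qed

lemma monomials_to_I: "awalk u p w \<Longrightarrow> awalk v q w \<Longrightarrow> int (length p) - int (length q) \<in> D \<Longrightarrow>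
    length q \<le> n \<Longrightarrow> P u p * G v q \<in> monomials_to n D v"
  unfolding monomials_to_def mem_Collect_eq by (intro exI conjI) (rule refl, assumption+)

lemma monomials_to_mono: "n \<le> n' \<Longrightarrow> monomials_to n D v \<subseteq> monomials_to n' D v"
  unfolding monomials_to_def using order_trans by blast

lemma right_vertex:
  assumes "x \<in> span (monomials D)" "v \<in> verts E"
  shows "\<exists>n. x * P v [] \<in> span (monomials_to n D v)"
  using assms(1)
proof (induction rule: span.induct)
  case (base x)
  then show ?case using assms by (auto intro: span.base)
next
  case (step s y c)
  then obtain n where n: "y * P v [] \<in> span (monomials_to n D v)" by blast
  obtain u p v' q w where s: "s = P u p * G v' q" and w: "awalk u p w" "awalk v' q w"
    and D: "int (length p) - int (length q) \<in> D"
    using step(1) unfolding monomials_def by blast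
  let ?m = "max n (length q)"
  have "s * P v [] \<in> span (monomials_to ?m D v)"
  proof (cases "v' = v")
    case True
    have "s * P v [] \<approx> s" using vertex_absorbs_monomial [OF w] unfolding s True .
    moreover have "s \<in> span (monomials_to ?m D v)"
      unfolding s True by (intro span_generator monomials_to_I [OF w(1) w(2) [unfolded True] D]) simp
    ultimately show ?thesis by (rule span_eqv_sym)
  next
    case False
    then show ?thesis using other_vertex_kills_monomial [OF w assms(2)] unfolding s by (intro span.base) auto
  qed
  moreover have "y * P v [] \<in> span (monomials_to ?m D v)"
    using n by (rule span_subset) (use monomials_to_mono [of n ?m] in auto)
  ultimately have "sc c * (s * P v []) + y * P v [] \<in> span (monomials_to ?m D v)"
    by (intro span_add span_sc)
  then show ?case by (auto simp: distrib_right mult.assoc)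
qed

section \<open>Conjugation of closed paths\<close>

lemma closed_paths_I: "awalk v p v \<Longrightarrow> p \<noteq> [] \<Longrightarrow> P v p \<in> closed_paths UNIV v"
proof -
  assume "awalk v p v" "p \<noteq> []"
  moreover have "int (length p) = int (length p) - 0" by simp
  ultimately show ?thesis unfolding closed_paths_def by blast
qed

text \<open>
  For a closed path \<open>q\<close> at the start of \<open>p\<close>, the path \<open>q @ p\<close> either extends \<open>p\<close>, and then the excess has
  the length of \<open>q\<close>, or is annihilated by the ghost of \<open>p\<close>.
\<close>
lemma conjugate_closed_paths:
  assumes t: "t \<in> span (closed_paths D v)" and p: "awalk v p y"
  shows "G v p * t * P v p \<in> span (closed_paths UNIV y)"
proof -
  have "G v p * s * P v p \<in> span (closed_paths UNIV y)" if s: "s \<in> closed_paths D v" for s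
  proof -
    obtain q where q: "s = P v q" "awalk v q v" "q \<noteq> []" using s by (auto simp: closed_paths_def)
    have "G v p * s * P v p \<approx> G v p * P v (q @ p)"
      unfolding q mult.assoc using p q by (auto intro!: eqv_mult_left P_append)
    moreover have "G v p * P v (q @ p) \<in> span (closed_paths UNIV y)"
    proof (cases "\<exists>t. q @ p = p @ t")
      case True
      then obtain t where qp: "q @ p = p @ t" by blast
      have "awalk v (q @ p) y" using p q by simp
      then obtain y' where "awalk v p y'" "awalk y' t y" unfolding qp by auto
      then have t: "awalk y t y" using awalk_ends_eqD p by blast
      have "t \<noteq> []" using qp q(3) by auto
      then have "P y t \<in> span (closed_paths UNIV y)" using t by (intro span_generator closed_paths_I)
      moreover have "G v p * P v (q @ p) \<approx> P y t" unfolding qp using p t by (rule GP_prefix)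
      ultimately show ?thesis by (rule span_eqv_sym [rotated])
    next
      case False
      have "G v p * P v (q @ p) \<in> N"
        using p q False by (intro GP_orthogonal) auto
      then show ?thesis by (rule span.base)
    qed
    ultimately show ?thesis by (rule span_eqv_sym)
  qed
  note generators = this
  have C: "G v p \<in> C" "P v p \<in> C" using p by auto
  show ?thesis
    using t
  proof (induction rule: span.induct)
    case (base x)
    then show ?case using C by (intro span.base) auto
  next
    case (step s x c)
    then have "sc c * (G v p * s * P v p) + G v p * x * P v p \<in> span (closed_paths UNIV y)"
      by (intro span_add [OF span_sc [OF generators]])
    moreover have "G v p * (sc c * s + x) * P v p = sc c * (G v p * s * P v p) + G v p * x * P v p"
      by (simp add: distrib_left distrib_right sc_left_commute mult.assoc)
    ultimately show ?case by simp
  qed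
qed

lemma conjugate:
  assumes t: "t \<in> span (closed_paths D v)" and x: "x \<approx> sc c * P v [] + t" and p: "awalk v p y"
  shows "\<exists>t'\<in>span (closed_paths UNIV y). G v p * x * P v p \<approx> sc c * P y [] + t'"
proof (intro bexI)
  have v: "v \<in> verts E" using p by auto
  have "G v p * x * P v p \<approx> G v p * (sc c * P v [] + t) * P v p"
    using x p by (intro eqv_mult_right eqv_mult_left) auto
  also have "\<dots> = sc c * (G v p * (P v [] * P v p)) + G v p * t * P v p"
    by (simp add: distrib_left distrib_right sc_left_commute mult.assoc)
  also have "\<dots> \<approx> sc c * (G v p * P v p) + G v p * t * P v p"
    using p by (intro eqv_add [OF eqv_sc [OF eqv_mult_left [OF vertex_P]] eqv_refl]) auto
  also have "\<dots> \<approx> sc c * P y [] + G v p * t * P v p"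
    using GP_prefix [OF p, of "[]" y] p by (intro eqv_add [OF eqv_sc eqv_refl]) (auto dest: awalk_last_in_verts)
  finally show "G v p * x * P v p \<approx> sc c * P y [] + G v p * t * P v p" .
  show "G v p * t * P v p \<in> span (closed_paths UNIV y)" by (rule conjugate_closed_paths [OF t p])
qed

section \<open>Reduction to a vertex\<close>

lemma real_normal_form:
  assumes "x \<in> span (real_paths D v)"
  shows "\<exists>F c. finite F \<and> (\<forall>(u, p)\<in>F. awalk u p v \<and> int (length p) \<in> D) \<and>
    x \<approx> (\<Sum>i\<in>F. sc (c i) * P (fst i) (snd i))"
  using assms
proof (induction rule: span.induct)
  case (base x)
  then show ?case by (intro exI [of _ "{}"]) auto
next
  case (step s y d)
  then obtain F c where F: "finite F" "\<forall>(u, p)\<in>F. awalk u p v \<and> int (length p) \<in> D"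
    "y \<approx> (\<Sum>i\<in>F. sc (c i) * P (fst i) (snd i))" by blast
  obtain u p where s: "s = P u p" "awalk u p v" "int (length p) \<in> D" using step by (auto simp: real_paths_def)
  define c' where "c' = (\<lambda>i. (if i \<in> F then c i else 0) + (if i = (u, p) then d else 0))"
  have "(\<Sum>i\<in>insert (u, p) F. sc (c' i) * P (fst i) (snd i)) =
      (\<Sum>i\<in>insert (u, p) F. if i \<in> F then sc (c i) * P (fst i) (snd i) else 0) +
      (\<Sum>i\<in>insert (u, p) F. if i = (u, p) then sc d * P u p else 0)"
    unfolding sum.distrib [symmetric] by (rule sum.cong) (auto simp: c'_def single_add distrib_right)
  also have "(\<Sum>i\<in>insert (u, p) F. if i \<in> F then sc (c i) * P (fst i) (snd i) else 0) = (\<Sum>i\<in>F. sc (c i) * P (fst i) (snd i))"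
    using F(1) by (intro sum.mono_neutral_cong_right) auto
  also have "(\<Sum>i\<in>insert (u, p) F. if i = (u, p) then sc d * P u p else 0) = sc d * s"
    using F(1) by (simp add: s)
  finally have "sc d * s + y \<approx> (\<Sum>i\<in>insert (u, p) F. sc (c' i) * P (fst i) (snd i))"
    using eqv_add [OF eqv_refl F(3), of "sc d * s"] by (simp add: add.commute)
  moreover have "\<forall>(u, p)\<in>insert (u, p) F. awalk u p v \<and> int (length p) \<in> D" using F(2) s by simp
  ultimately show ?case using F(1) by (meson finite_insert)
qed

text \<open>
  The ghost of a shortest path with nonzero coefficient turns this path into its end vertex. Every other
  path is at least as long, hence becomes zero or a closed path; it is not a vertex because it differs
  from the chosen path.
\<close>
lemma reduce_real:
  assumes x: "x \<in> span (real_paths D v)" "x \<notin> N"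
  obtains u p c t where "awalk u p v" "c \<noteq> 0" "t \<in> span (closed_paths D v)" "G u p * x \<approx> sc c * P v [] + t"
proof -
  obtain F c where F: "finite F" "\<forall>(u, p)\<in>F. awalk u p v \<and> int (length p) \<in> D"
    and xF: "x \<approx> (\<Sum>i\<in>F. sc (c i) * P (fst i) (snd i))"
    using real_normal_form [OF x(1)] by blast
  define F' where "F' = {i\<in>F. c i \<noteq> 0}"
  have "(\<Sum>i\<in>F. sc (c i) * P (fst i) (snd i)) = (\<Sum>i\<in>F'. sc (c i) * P (fst i) (snd i))"
    using F(1) by (intro sum.mono_neutral_right) (auto simp: F'_def)
  with xF have xF': "x \<approx> (\<Sum>i\<in>F'. sc (c i) * P (fst i) (snd i))" by simp
  then have "F' \<noteq> {}" using x(2) by auto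
  moreover have fin: "finite F'" using F by (simp add: F'_def)
  ultimately obtain i where i: "i \<in> F'" "\<And>j. j \<in> F' \<Longrightarrow> length (snd i) \<le> length (snd j)"
    using ex_min_if_finite [of "(length \<circ> snd) ` F'"] by (auto simp: not_less)
  obtain u p where up: "i = (u, p)" by (cases i)
  have p: "awalk u p v" "int (length p) \<in> D" using i F(2) by (auto simp: F'_def up)
  define t where "t = (\<Sum>j\<in>F' - {i}. sc (c j) * (G u p * P (fst j) (snd j)))"
  have "G u p * x \<approx> G u p * (\<Sum>j\<in>F'. sc (c j) * P (fst j) (snd j))" using p by (intro eqv_mult_left xF') auto
  also have "\<dots> = (\<Sum>j\<in>F'. sc (c j) * (G u p * P (fst j) (snd j)))"
    by (simp add: sum_distrib_left sc_left_commute)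
  also have "\<dots> = sc (c i) * (G u p * P u p) + t"
    using fin i up by (simp add: t_def sum.remove)
  also have "\<dots> \<approx> sc (c i) * P v [] + t"
    using GP_prefix [OF p(1), of "[]" v] p by (intro eqv_add eqv_sc) (auto dest: awalk_last_in_verts)
  finally have "G u p * x \<approx> sc (c i) * P v [] + t" .
  moreover have "t \<in> span (closed_paths D v)"
    unfolding t_def
  proof (intro span_sum span_sc)
    fix j assume j: "j \<in> F' - {i}"
    obtain u' q where uq: "j = (u', q)" by (cases j)
    have q: "awalk u' q v" "int (length q) \<in> D" "length p \<le> length q" using j F(2) i(2) [of j] by (auto simp: F'_def uq up)
    have "G u p * P u' q \<in> span (closed_paths D v)"
    proof (cases "u = u' \<and> (\<exists>t. q = p @ t)")
      case True
      then obtain t where t: "u' = u" "q = p @ t" by blast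
      have "t \<noteq> []" using j t up uq by auto
      moreover obtain v' where "awalk u p v'" "awalk v' t v" using q(1) unfolding t by auto
      then have "awalk v t v" using awalk_ends_eqD p(1) by blast
      moreover have "int (length t) = int (length q) - int (length p)" using t by simp
      ultimately have "P v t \<in> closed_paths D v" using p q unfolding closed_paths_def by blast
      moreover have "G u p * P u' q \<approx> P v t" unfolding t using p(1) \<open>awalk v t v\<close> by (rule GP_prefix)
      ultimately show ?thesis by (intro span_eqv_sym [OF _ span_generator])
    next
      case False
      then show ?thesis using GP_orthogonal [OF p(1) q(1,3)] by (intro span.base)
    qed
    then show "G u p * P (fst j) (snd j) \<in> span (closed_paths D v)" by (simp add: uq)
  qed
  moreover have "c i \<noteq> 0" using i by (simp add: F'_def)
  ultimately show ?thesis using that p by blast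
qed

text \<open>
  Otherwise \<open>reduce_real\<close> followed by conjugation with \<open>e\<close> produces a multiple of \<open>head E e\<close> plus closed
  paths, and this is not zero although \<open>x * e\<close> divides it.
\<close>
lemma real_edge_injective:
  assumes x: "x \<in> span (real_paths D v)" and e: "e \<in> out_arcs E v" and xe: "x * P v [e] \<in> N"
  shows "x \<in> N"
proof (rule ccontr)
  assume "x \<notin> N"
  then obtain u p c t where red: "awalk u p v" "c \<noteq> 0" "t \<in> span (closed_paths D v)" "G u p * x \<approx> sc c * P v [] + t"
    using reduce_real [OF x] by metis
  have e': "e \<in> arcs E" "awalk v [e] (head E e)" using e by (auto simp: awalk_Cons_iff)
  from conjugate [OF red(3,4) e'(2)] obtain t' where t': "t' \<in> span (closed_paths UNIV (head E e))"
    "G v [e] * (G u p * x) * P v [e] \<approx> sc c * P (head E e) [] + t'"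
    by (rule bexE)
  have "G v [e] * (G u p * (x * P v [e])) \<in> N" using e' red(1) by (intro N_mult_left [OF N_mult_left [OF xe]]) auto
  then have "sc c * P (head E e) [] + t' \<in> N" using eqv_N [OF t'(2)] by (simp add: mult.assoc)
  then show False using vertex_notin_N [OF red(2) t'(1)] by simp
qed

lemma ghost_edge_monomial:
  assumes w: "awalk u p w" "awalk v (f # q) w" and e: "e \<in> out_arcs E v"
  shows "P u p * G v (f # q) * P v [e] \<approx> (if e = f then P u p * G (head E e) q else 0)"
proof -
  have f: "f \<in> arcs E" "v = tail E f" "awalk (head E f) q w" using w by (auto simp: awalk_Cons_iff)
  have e': "e \<in> arcs E" using e by simp
  have "P u p * G v (f # q) * P v [e] \<approx> P u p * (G (head E f) q * G v [f]) * P v [e]"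
    using w e' by (auto intro!: eqv_mult_right eqv_mult_left G_Cons)
  also have "\<dots> = P u p * (G (head E f) q * (G v [f] * P v [e]))" by (simp add: mult.assoc)
  finally have *: "P u p * G v (f # q) * P v [e] \<approx> P u p * (G (head E f) q * (G v [f] * P v [e]))" .
  show ?thesis
  proof (cases "e = f")
    case True
    have "P u p * (G (head E f) q * (G v [f] * P v [e])) \<approx> P u p * (G (head E f) q * P (head E f) [])"
      unfolding True using w f by (intro eqv_mult_left edge_mult(5)) auto
    also have "\<dots> \<approx> P u p * G (head E f) q" using w f by (auto intro!: eqv_mult_left G_vertex)
    finally show ?thesis using eqv_trans [OF *] True by simp
  next
    case False
    then have "P u p * (G (head E f) q * (G v [f] * P v [e])) \<in> N"
      using w f e' by (intro N_mult_left [OF N_mult_left [OF edge_mult(6)]]) auto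
    then show ?thesis using eqv_N [OF *] False by simp
  qed
qed

lemma right_edge:
  assumes x: "x \<in> span (monomials_to n D v)" and e: "e \<in> out_arcs E v"
  shows "x * P v [e] \<in> span (monomials_to (n - 1) ((+) 1 ` D) (head E e))"
proof (rule span_mult_right [OF x])
  show "P v [e] \<in> C" using e by auto
  fix s assume "s \<in> monomials_to n D v"
  then obtain u p q w where s: "s = P u p * G v q" and w: "awalk u p w" "awalk v q w"
    and D: "int (length p) - int (length q) \<in> D" and n: "length q \<le> n"
    unfolding monomials_to_def by blast
  have e': "e \<in> arcs E" "awalk v [e] (head E e)" using e by (auto simp: awalk_Cons_iff)
  show "s * P v [e] \<in> span (monomials_to (n - 1) ((+) 1 ` D) (head E e))"
  proof (cases q)
    case Nil
    then have [simp]: "w = v" "v \<in> verts E" using w by (auto simp: awalk_Nil_iff)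
    have pe: "awalk u (p @ [e]) (head E e)" using w e' by auto
    have "s * P v [e] = P u p * (P v [] * P v [e])" unfolding s Nil G_Nil by (simp add: mult.assoc)
    also have "\<dots> \<approx> P u p * P v [e]" using w e' by (auto intro!: eqv_mult_left vertex_P)
    also have "\<dots> \<approx> P u (p @ [e])" using w e' by (auto intro!: P_append)
    also have "\<dots> \<approx> P u (p @ [e]) * P (head E e) []" using pe by (intro eqv_sym [OF P_vertex])
    finally have "s * P v [e] \<approx> P u (p @ [e]) * G (head E e) []" by (simp add: G_Nil)
    moreover have "P u (p @ [e]) * G (head E e) [] \<in> monomials_to (n - 1) ((+) 1 ` D) (head E e)"
      using D Nil pe e' by (intro monomials_to_I [OF pe]) auto
    ultimately show ?thesis by (intro span_eqv_sym [OF _ span_generator])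
  next
    case (Cons f q')
    have *: "s * P v [e] \<approx> (if e = f then P u p * G (head E e) q' else 0)"
      unfolding s Cons using w e Cons by (intro ghost_edge_monomial) auto
    moreover have "P u p * G (head E e) q' \<in> monomials_to (n - 1) ((+) 1 ` D) (head E e)" if "e = f"
    proof (rule monomials_to_I [OF w(1)])
      show "awalk (head E e) q' w" using w Cons that by (auto simp: awalk_Cons_iff)
      show "length q' \<le> n - 1" using n Cons by simp
      show "int (length p) - int (length q') \<in> (+) 1 ` D"
        using D Cons by (intro image_eqI [of _ _ "int (length p) - int (length q)"]) auto
    qed
    ultimately have "(if e = f then P u p * G (head E e) q' else 0) \<in> span (monomials_to (n - 1) ((+) 1 ` D) (head E e))"
      by (simp add: span_generator span.base)
    with * show ?thesis by (rule span_eqv_sym)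
  qed
qed

lemma monomials_to_0: "x \<in> span (monomials_to 0 D v) \<Longrightarrow> x \<in> span (real_paths D v)"
proof (erule span_subset)
  fix s assume "s \<in> monomials_to 0 D v"
  then obtain u p where s: "s = P u p * P v []" "awalk u p v" "int (length p) \<in> D"
    unfolding monomials_to_def by (auto simp: awalk_Nil_iff G_Nil)
  then have "P u p \<approx> s" "P u p \<in> real_paths D v" using P_vertex by (auto intro: eqv_sym simp: real_paths_def)
  then show "s \<in> span (real_paths D v)" by (intro span_eqv [OF span_generator])
qed

text \<open>
  The monomials with at least one ghost edge are absorbed by the idempotents \<open>e e\<^sup>*\<close>.
\<close>
lemma split_real:
  assumes "x \<in> span (monomials_to n D v)"
  shows "\<exists>x' y. x \<approx> x' + y \<and> x' \<in> span (real_paths D v) \<and> y \<in> C \<and>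
    absorbed (out_arcs E v) (\<lambda>e. P v [e] * G v [e]) y"
  using assms
proof (induction rule: span.induct)
  case (base x)
  then have "absorbed (out_arcs E v) (\<lambda>e. P v [e] * G v [e]) 0"
    by (auto simp: absorbed_def)
  then show ?case using base by (intro exI [of _ 0]) (auto intro: span.base)
next
  case (step s y c)
  then obtain x' y' where IH: "y \<approx> x' + y'" "x' \<in> span (real_paths D v)" "y' \<in> C"
     "absorbed (out_arcs E v) (\<lambda>e. P v [e] * G v [e]) y'" by blast
  obtain u p q w where s: "s = P u p * G v q" and w: "awalk u p w" "awalk v q w"
    and D: "int (length p) - int (length q) \<in> D"
    using step(1) unfolding monomials_to_def by blast
  show ?case
  proof (cases q)
    case Nil
    then have "s \<in> monomials_to 0 D v" unfolding s using w D by (intro monomials_to_I) auto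
    then have "sc c * s + x' \<in> span (real_paths D v)"
      using IH(2) by (intro span_add [OF span_sc [OF monomials_to_0 [OF span_generator]]])
    moreover have "sc c * s + y \<approx> sc c * s + x' + y'" using IH(1) by (simp add: add.assoc eqv_add)
    ultimately show ?thesis using IH(3,4) by blast
  next
    case (Cons f q')
    have f: "f \<in> out_arcs E v" "f \<in> arcs E" "awalk (head E f) q' w" using w Cons by (auto simp: awalk_Cons_iff)
    have "s * (P v [f] * G v [f]) = s * P v [f] * G v [f]" by (simp add: mult.assoc)
    also have "\<dots> \<approx> P u p * G (head E f) q' * G v [f]"
      using ghost_edge_monomial [of u p w v f q' f] w f unfolding s Cons by (intro eqv_mult_right) auto
    also have "\<dots> = P u p * (G (head E f) q' * G v [f])" by (simp add: mult.assoc)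
    also have "\<dots> \<approx> s" unfolding s Cons
      using w by (intro eqv_mult_left [OF eqv_sym [OF G_Cons [OF w(2) [unfolded Cons]]]]) auto
    finally have "absorbed (out_arcs E v) (\<lambda>e. P v [e] * G v [e]) s"
      unfolding absorbed_def using f(1) w s by (intro conjI exI [of _ "{f}"]) simp_all
    with IH(4) have gen: "absorbed (out_arcs E v) (\<lambda>e. P v [e] * G v [e]) x" if "x \<in> {s, y'}" for x
      using that by (elim insertE) simp_all
    have "sc c * s + y' \<in> span {s, y'}" by (intro span.step span_generator) simp_all
    then have "absorbed (out_arcs E v) (\<lambda>e. P v [e] * G v [e]) (sc c * s + y')"
      by (rule absorbed_span [OF orthogonal_edges _ gen])
    moreover have "sc c * s + y \<approx> x' + (sc c * s + y')" using eqv_add [OF eqv_refl IH(1), of "sc c * s"]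
      by (simp add: ac_simps)
    moreover have "sc c * s + y' \<in> C" using IH(3) w s by auto
    ultimately show ?thesis using IH(2) by blast
  qed
qed

text \<open>
  Write \<open>x = x' + y\<close> as in \<open>split_real\<close> and suppose that all edges kill \<open>x\<close>. With the finite sum \<open>q\<close> of the
  idempotents \<open>e e\<^sup>*\<close> that absorbs \<open>y\<close>, this gives \<open>x = x' (v - q)\<close>. If \<open>q\<close> involves all edges at \<open>v\<close>,
  then \<open>v = q\<close> by the relation at regular vertices. Otherwise a further edge \<open>f\<close> satisfies
  \<open>0 = x f = x' f\<close>, whence \<open>x' = 0\<close>.
\<close>
lemma some_edge_survives:
  assumes x: "x \<in> span (monomials_to n D v)" "x \<notin> N" and v: "v \<in> verts E" "out_arcs E v \<noteq> {}"
  shows "\<exists>e\<in>out_arcs E v. x * P v [e] \<notin> N"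
proof (rule ccontr)
  assume "\<not> ?thesis"
  then have killed: "x * P v [e] \<in> N" if "e \<in> out_arcs E v" for e using that by blast
  obtain x' y where xy: "x \<approx> x' + y" "x' \<in> span (real_paths D v)" "y \<in> C"
    "absorbed (out_arcs E v) (\<lambda>e. P v [e] * G v [e]) y" using split_real [OF x(1)] by blast
  then obtain F where F: "finite F" "F \<subseteq> out_arcs E v" "y * (\<Sum>e\<in>F. P v [e] * G v [e]) \<approx> y"
    unfolding absorbed_def by blast
  define q where "q = (\<Sum>e\<in>F. P v [e] * G v [e])"
  have q: "q \<in> C" unfolding q_def using F by (intro C_sum) auto
  have x': "x' \<in> C" using xy by auto
  have "x * q = (\<Sum>e\<in>F. x * P v [e] * G v [e])" unfolding q_def by (simp add: sum_distrib_left mult.assoc)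
  also have "\<dots> \<approx> (\<Sum>e\<in>F. 0)" using F killed by (intro eqv_sum) auto
  finally have "x * q \<in> N" by simp
  moreover have "x * q \<approx> (x' + y) * q" using xy(1) q by (rule eqv_mult_right)
  ultimately have "(x' + y) * q \<in> N" using eqv_N by blast
  then have "x' * q + y * q \<in> N" by (simp add: distrib_right)
  moreover have "x' * q + y * q \<approx> x' * q + y" using F(3) unfolding q_def by (intro eqv_add) auto
  ultimately have *: "x' * q + y \<in> N" using eqv_N by blast
  have xq: "x \<approx> x' - x' * q"
  proof -
    have "x \<approx> x' + y" by (rule xy)
    also have "x' + y \<approx> x' - x' * q" using * unfolding eqv_def by (simp add: algebra_simps)
    finally show ?thesis .
  qed
  show False
  proof (cases "F = out_arcs E v")
    case True
    have "P v [] - q \<in> N"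
      using N_relation [OF regular_vertex [of v E]] v F(1) unfolding True q_def
      by (simp add: path_word_def ghost_word_def)
    then have "x' * P v [] - x' * q \<in> N" using x' by (metis N_mult_left right_diff_distrib)
    moreover have "x' * P v [] \<approx> x'"
    proof -
      have "x' * P v [] - x' \<in> N"
        using xy(2)
      proof (induction rule: span.induct)
        case (base x)
        then show ?case using v by auto
      next
        case (step s y c)
        then obtain u p where "s = P u p" "awalk u p v" by (auto simp: real_paths_def)
        then have "sc c * (s * P v [] - s) + (y * P v [] - y) \<in> N" using step P_vertex by (intro N_add N_sc) (auto simp: eqv_def)
        then show ?case by (simp add: algebra_simps)
      qed
      then show ?thesis by (simp add: eqv_def)
    qed
    then have "x' * P v [] - x' * q \<approx> x' - x' * q" by (intro eqv_diff) auto
    ultimately have "x' - x' * q \<in> N" using eqv_N by metis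
    then show False using eqv_N [OF xq] x(2) by simp
  next
    case False
    then obtain f where f: "f \<in> out_arcs E v" "f \<notin> F" using F by blast
    have Pf: "P v [f] \<in> C" using f by auto
    have "x' * (q * P v [f]) \<in> N"
    proof (rule N_mult_left [OF _ x'])
      have "(\<Sum>e\<in>F. P v [e] * (G v [e] * P v [f])) \<approx> (\<Sum>e\<in>F. 0)"
      proof (rule eqv_sum)
        fix e assume "e \<in> F"
        then have "P v [e] * (G v [e] * P v [f]) \<in> N"
          using F(2) f by (intro N_mult_left [OF edge_mult(6)]) auto
        then show "P v [e] * (G v [e] * P v [f]) \<approx> 0" by simp
      qed
      then show "q * P v [f] \<in> N" unfolding q_def by (simp add: sum_distrib_right mult.assoc)
    qed
    moreover have "(x' - x' * q) * P v [f] \<in> N"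
      using eqv_N [OF eqv_mult_right [OF xq Pf]] killed [OF f(1)] by simp
    ultimately have "(x' - x' * q) * P v [f] + x' * (q * P v [f]) \<in> N" by (rule N_add [rotated])
    then have "x' * P v [f] \<in> N" by (simp add: left_diff_distrib mult.assoc)
    then have "x' \<in> N" using real_edge_injective [OF xy(2) f(1)] by blast
    then have "x' - x' * q \<in> N" using q by auto
    then show False using eqv_N [OF xq] x(2) by simp
  qed
qed

lemma reduce_to_real:
  assumes "x \<in> span (monomials_to n D v)" "x \<notin> N" "v \<in> verts E"
  shows "\<exists>b\<in>C. \<exists>w\<in>verts E. \<exists>k. x * b \<notin> N \<and> x * b \<in> span (real_paths ((+) k ` D) w)"
  using assms
proof (induction n arbitrary: x v D)
  case 0
  have "x * P v [] \<approx> x"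
    using 0(1)
  proof (induction rule: span.induct)
    case (base x)
    then show ?case using 0 by (simp add: eqv_def)
  next
    case (step s y c)
    then have "s * P v [] \<approx> s" unfolding monomials_to_def using vertex_absorbs_monomial by blast
    then have "sc c * (s * P v []) + y * P v [] \<approx> sc c * s + y" using step by (intro eqv_add eqv_sc)
    then show ?case by (simp add: distrib_right mult.assoc)
  qed
  moreover have "x \<in> span (real_paths ((+) 0 ` D) v)" using monomials_to_0 [OF 0(1)] by simp
  ultimately have "x * P v [] \<notin> N \<and> x * P v [] \<in> span (real_paths ((+) 0 ` D) v)"
    using 0(2) eqv_N span_eqv_sym by metis
  then show ?case using 0(3) by (intro bexI [of _ "P v []"] bexI [of _ v] exI [of _ 0]) auto
next
  case (Suc n)
  show ?case
  proof (cases "out_arcs E v = {}")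
    case True
    have "x \<in> span (monomials_to n D v)"
    proof (rule span_subset [OF Suc.prems(1)])
      fix s assume "s \<in> monomials_to (Suc n) D v"
      then obtain u p q w where s: "s = P u p * G v q" and w: "awalk u p w" "awalk v q w"
        and D: "int (length p) - int (length q) \<in> D"
        unfolding monomials_to_def by blast
      have "q = []" using w(2) True by (cases q) (auto simp: awalk_Cons_iff)
      then show "s \<in> span (monomials_to n D v)" unfolding s using w D by (intro span_generator monomials_to_I) auto
    qed
    then show ?thesis by (rule Suc.IH [OF _ Suc.prems(2,3)])
  next
    case False
    obtain e where e: "e \<in> out_arcs E v" "x * P v [e] \<notin> N"
      using some_edge_survives [OF Suc.prems False] by (rule bexE)
    have "x * P v [e] \<in> span (monomials_to n ((+) 1 ` D) (head E e))"
      using right_edge [OF Suc.prems(1) e(1)] by simp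
    moreover have "head E e \<in> verts E" using e(1) by simp
    ultimately obtain b w k where b: "b \<in> C" "w \<in> verts E" "x * P v [e] * b \<notin> N"
      "x * P v [e] * b \<in> span (real_paths ((+) k ` (+) 1 ` D) w)"
      using Suc.IH [OF _ e(2)] by metis
    have "P v [e] * b \<in> C" using e(1) b(1) by auto
    moreover have "(+) k ` (+) 1 ` D = (+) (k + 1) ` D" by (auto simp: image_image add.assoc)
    ultimately show ?thesis using b
      by (intro bexI [of _ "P v [e] * b"] bexI [of _ w] exI [of _ "k + 1"]) (simp_all add: mult.assoc)
  qed
qed

text \<open>
  In the conclusion the set \<open>D\<close> of degrees enters only through its differences, which do not change when
  \<open>D\<close> is shifted by the degrees of the multipliers.
\<close>
lemma reduction:
  assumes x: "x \<in> span (monomials D)" "x \<notin> N"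
  obtains a b c v t where "a \<in> C" "b \<in> C" "c \<noteq> 0" "v \<in> verts E" "t \<in> span (closed_paths D v)"
    "a * x * b \<approx> sc c * P v [] + t"
proof -
  have "absorbed (verts E) (\<lambda>v. P v []) x"
  proof (rule absorbed_span [OF orthogonal_vertices x(1)])
    fix s assume "s \<in> monomials D"
    then obtain u p v q w where s: "s = P u p * G v q" and w: "awalk u p w" "awalk v q w"
      unfolding monomials_def by blast
    then show "absorbed (verts E) (\<lambda>v. P v []) s"
      using vertex_absorbs_monomial [OF w] unfolding absorbed_def s by (intro conjI exI [of _ "{v}"]) auto
  qed
  then obtain v where v: "v \<in> verts E" "x * P v [] \<notin> N" using absorbed_nonzero x by blast
  obtain n where "x * P v [] \<in> span (monomials_to n D v)" using right_vertex [OF x(1) v(1)] by blast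
  then obtain b w k where b: "b \<in> C" "w \<in> verts E" "x * P v [] * b \<notin> N"
      "x * P v [] * b \<in> span (real_paths ((+) k ` D) w)"
    using reduce_to_real [OF _ v(2,1)] by metis
  obtain u p c t where red: "awalk u p w" "c \<noteq> 0" "t \<in> span (closed_paths ((+) k ` D) w)"
    "G u p * (x * P v [] * b) \<approx> sc c * P w [] + t"
    using reduce_real [OF b(4,3)] by metis
  \<comment> \<open>differences of degrees are invariant under the shift by \<open>k\<close>\<close>
  have "closed_paths ((+) k ` D) w = closed_paths D w" by (auto simp: closed_paths_def)
  moreover have "G u p * x * (P v [] * b) \<approx> sc c * P w [] + t" using red by (simp add: mult.assoc)
  ultimately show ?thesis using red b v that [of "G u p" "P v [] * b" c w t] by auto
qed

lemma reduction_to_vertex: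
  assumes "x \<in> C" "x \<notin> N"
  obtains a b c v t where "a \<in> C" "b \<in> C" "c \<noteq> 0" "v \<in> verts E" "t \<in> span (closed_paths UNIV v)"
    "a * x * b \<approx> sc c * P v [] + t"
  using reduction [OF C_span] assms by metis

lemma reduction_homogeneous:
  assumes "x \<in> span (monomials {k})" "x \<notin> N"
  obtains a b c v where "a \<in> C" "b \<in> C" "c \<noteq> 0" "v \<in> verts E" "a * x * b \<approx> sc c * P v []"
proof -
  obtain a b c v t where *: "a \<in> C" "b \<in> C" "c \<noteq> 0" "v \<in> verts E" "t \<in> span (closed_paths {k} v)"
    "a * x * b \<approx> sc c * P v [] + t"
    using reduction [OF assms] by metis
  have "closed_paths {k} v = {}" by (auto simp: closed_paths_def)
  then have "t \<in> N" using *(5) by (metis empty_iff span.simps)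
  then have "sc c * P v [] + t \<approx> sc c * P v []" by (simp add: eqv_def)
  then have "a * x * b \<approx> sc c * P v []" by (rule eqv_trans [OF *(6)])
  then show ?thesis using that *(1-4) by metis
qed

section \<open>Primeness forces a domain\<close>

lemma span_diff: "x \<in> span S \<Longrightarrow> y \<in> span S \<Longrightarrow> x - y \<in> span S"
proof -
  assume "x \<in> span S" "y \<in> span S"
  then have "x + sc (- 1) * y \<in> span S" by (intro span_add span_sc)
  moreover have "sc (- 1) * y = - y"
    using sc_one [of y] by (metis mult_minus_left single_uminus)
  ultimately show ?thesis by simp
qed

lemma sc_mult_sc: "sc a * f * (sc b * g) = sc (a * b) * (f * g)"
proof -
  have "sc a * f * (sc b * g) = sc a * (f * (sc b * g))" by (rule mult.assoc)
  also have "f * (sc b * g) = sc b * (f * g)" by (rule sc_left_commute)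
  finally show ?thesis by (simp only: sc_sc)
qed

lemma vertex_cls: "vertex R E v = cls (P v [])"
  by (simp add: vertex_def path_word_def)

lemma vertex_not_zero:
  assumes "(0::'r) \<noteq> 1"
  shows "P v [] \<notin> N"
  using vertex_notin_N [of 1 0 UNIV v] assms by (simp add: span.base)

lemma ideal_prod_zero:
  assumes "\<And>x y. x \<in> I \<Longrightarrow> y \<in> J \<Longrightarrow> x \<otimes>\<^bsub>L\<^esub> y = \<zero>\<^bsub>L\<^esub>" "x \<in> I" "y \<in> J"
  shows "ideal_prod L I J = {\<zero>\<^bsub>L\<^esub>}"
proof -
  have "z = \<zero>\<^bsub>L\<^esub>" if "z \<in> ideal_prod L I J" for z
    using that by (induction rule: ideal_prod.induct) (simp_all add: assms(1))
  moreover have "\<zero>\<^bsub>L\<^esub> \<in> ideal_prod L I J" using ideal_prod.prod [OF assms(2,3), of L] assms by simp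
  ultimately show ?thesis by blast
qed

lemma free_ideal_eqv:
  assumes "free_ideal I" "N \<subseteq> I" "x \<approx> y" "x \<in> I"
  shows "y \<in> I"
proof -
  have "y - x \<in> I" using assms(2,3) eqv_sym by (auto simp: eqv_def)
  then have "(y - x) + x \<in> I" using assms by (intro free_idealD(3))
  then show ?thesis by simp
qed

lemma free_ideal_sandwich: "free_ideal I \<Longrightarrow> x \<in> I \<Longrightarrow> a \<in> C \<Longrightarrow> b \<in> C \<Longrightarrow> a * x * b \<in> I"
  by (intro free_idealD(6) [OF _ _ free_idealD(5)])

lemma prime_imp_nontrivial:
  assumes "prime_ring L"
  shows "(0::'r) \<noteq> 1"
proof
  assume 01: "(0::'r) = 1"
  have "f = 0" for f :: "('v, 'e, 'r) words"
    using sc_one [of f] unfolding 01 [symmetric] by simp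
  then have "C = {0}" using C_zero by blast
  then show False using assms by (simp add: prime_ring_def L_carrier L_zero)
qed

lemma prime_ringD:
  assumes "prime_ring L" "two_sided_ideal I L" "two_sided_ideal J L" "ideal_prod L I J = {\<zero>\<^bsub>L\<^esub>}"
  shows "I = {\<zero>\<^bsub>L\<^esub>} \<or> J = {\<zero>\<^bsub>L\<^esub>}"
  using assms by (simp add: prime_ring_def)

lemma prime_imp_domain:
  assumes pr: "prime_ring L" and v: "v \<in> verts E"
  shows "integral_domain R"
proof -
  let ?J = "\<lambda>c. cls ` (\<lambda>f. sc c * f) ` C"
  have id: "two_sided_ideal (?J c) L" for c
  proof (rule image_ideal)
    show "free_ideal ((\<lambda>f. sc c * f) ` C)"
      unfolding free_ideal_def
    proof (intro conjI ballI)
      show "0 \<in> (\<lambda>f. sc c * f) ` C" by (rule image_eqI [of _ _ 0]) simp_all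
      show "- x \<in> (\<lambda>f. sc c * f) ` C" if "x \<in> (\<lambda>f. sc c * f) ` C" for x
      proof -
        obtain f where "f \<in> C" "x = sc c * f" using \<open>x \<in> _\<close> by blast
        then show ?thesis by (intro image_eqI [of _ _ "- f"]) simp_all
      qed
      show "x + y \<in> (\<lambda>f. sc c * f) ` C" if "x \<in> (\<lambda>f. sc c * f) ` C" "y \<in> (\<lambda>f. sc c * f) ` C" for x y
      proof -
        obtain f g where "f \<in> C" "x = sc c * f" "g \<in> C" "y = sc c * g" using \<open>x \<in> _\<close> \<open>y \<in> _\<close> by blast
        then show ?thesis by (intro image_eqI [of _ _ "f + g"]) (simp_all add: distrib_left)
      qed
      fix a x assume "a \<in> C" and "x \<in> (\<lambda>f. sc c * f) ` C"
      then obtain f where f: "f \<in> C" "x = sc c * f" by blast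
      show "a * x \<in> (\<lambda>f. sc c * f) ` C"
        using f \<open>a \<in> C\<close> by (intro image_eqI [of _ _ "a * f"]) (simp_all add: sc_left_commute)
      show "x * a \<in> (\<lambda>f. sc c * f) ` C"
        using f \<open>a \<in> C\<close> by (intro image_eqI [of _ _ "f * a"]) (simp_all add: mult.assoc)
    qed auto
  qed
  have nz: "?J c \<noteq> {\<zero>\<^bsub>L\<^esub>}" if "c \<noteq> 0" for c
  proof
    assume "?J c = {\<zero>\<^bsub>L\<^esub>}"
    then have "cls (sc c * P v []) = cls 0" using v unfolding L_zero by blast
    then show False using vertex_notin_N [OF that, of 0 UNIV v] by (simp add: cls_eq_iff span.base)
  qed
  have "a = 0 \<or> b = 0" if "a * b = 0" for a b :: 'r
  proof -
    have "x \<otimes>\<^bsub>L\<^esub> y = \<zero>\<^bsub>L\<^esub>" if "x \<in> ?J a" "y \<in> ?J b" for x y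
    proof -
      obtain f g where fg: "f \<in> C" "x = cls (sc a * f)" "g \<in> C" "y = cls (sc b * g)" using \<open>x \<in> _\<close> \<open>y \<in> _\<close> by blast
      then show ?thesis using \<open>a * b = 0\<close> by (simp add: L_zero sc_mult_sc)
    qed
    then have "ideal_prod L (?J a) (?J b) = {\<zero>\<^bsub>L\<^esub>}"
      by (rule ideal_prod_zero) (use C_zero in blast)+
    then have "?J a = {\<zero>\<^bsub>L\<^esub>} \<or> ?J b = {\<zero>\<^bsub>L\<^esub>}" by (rule prime_ringD [OF pr id id])
    then show ?thesis using nz by blast
  qed
  then show ?thesis using prime_imp_nontrivial [OF pr] by (simp add: integral_domain_def)
qed

section \<open>Disjoint kernels\<close>

lemma vertex_in_ker: "v \<in> Z \<Longrightarrow> v \<in> verts E \<Longrightarrow> P v [] \<in> ker Z"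
proof -
  assume v: "v \<in> Z" "v \<in> verts E"
  have "P v [] = gen (Vertex v)" by (simp add: path_word_def)
  moreover have "P v [] \<in> C" using v by simp
  ultimately show ?thesis using v by (simp add: ker_def act_gen)
qed

text \<open>
  The reduction of a nonzero element of both kernels would place its vertex in both sets.
\<close>
lemma disjoint_ker_inter:
  assumes "hereditary_saturated Z" "hereditary_saturated Z'" "Z \<inter> Z' = {}" "x \<in> ker Z" "x \<in> ker Z'"
  shows "x \<in> N"
proof (rule ccontr)
  assume "x \<notin> N"
  moreover have "x \<in> C" using assms by (simp add: ker_def)
  ultimately obtain a b c v t where red: "a \<in> C" "b \<in> C" "c \<noteq> 0" "v \<in> verts E" "t \<in> span (closed_paths UNIV v)"
    "a * x * b \<approx> sc c * P v [] + t" using reduction_to_vertex by metis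
  have "v \<in> Y" if Y: "hereditary_saturated Y" "x \<in> ker Y" for Y
  proof -
    have "a * x * b \<in> ker Y" using red Y by (intro free_ideal_sandwich [OF ker_ideal])
    then have "sc c * P v [] + t \<in> ker Y"
      by (rule free_ideal_eqv [OF ker_ideal N_subset_ker [OF Y(1)] red(6)])
    then show ?thesis using vertex_notin_ker [OF Y(1) _ red(3,5)] by blast
  qed
  then show False using assms by blast
qed

text \<open>
  This follows from \<open>disjoint_ker_inter\<close> since the empty set is disjoint from itself.
\<close>
lemma faithful: "x \<in> ker {} \<Longrightarrow> x \<in> N"
  using disjoint_ker_inter [of "{}" "{}"] hereditary_saturated_empty by simp

lemma connects_refl: "v \<in> verts E \<Longrightarrow> connects_to E v v"
  unfolding connects_to_def using awalk_Nil by blast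

lemma connects_trans: "connects_to E u v \<Longrightarrow> connects_to E v w \<Longrightarrow> connects_to E u w"
  unfolding connects_to_def using awalk_appendI by blast

lemma connects_edge: "e \<in> arcs E \<Longrightarrow> connects_to E (tail E e) (head E e)"
  unfolding connects_to_def using arc_implies_awalk by blast

lemma connects_verts: "connects_to E u v \<Longrightarrow> u \<in> verts E \<and> v \<in> verts E"
  unfolding connects_to_def by auto

lemma connects_first_edge:
  assumes "connects_to E u v" "u \<noteq> v"
  shows "\<exists>e\<in>out_arcs E u. connects_to E (head E e) v"
proof -
  obtain p where "awalk u p v" using assms(1) unfolding connects_to_def by blast
  then show ?thesis using assms(2)
    by (cases p) (auto simp: awalk_Nil_iff awalk_Cons_iff connects_to_def)
qed

text \<open>
  Let \<open>T\<close> be the set of descendants of \<open>v\<close>. The vertices that cannot reach \<open>T\<close> form a hereditary saturated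
  set, which contains \<open>w\<close>; the vertices that cannot reach this set form another one, which contains
  \<open>v\<close>. Avoiding a hereditary set is a saturated property because a path into that set can always be
  taken to have positive length.
\<close>
lemma separating_sets:
  assumes v: "v \<in> verts E" and w: "w \<in> verts E"
    and sep: "\<not> (\<exists>y\<in>verts E. connects_to E v y \<and> connects_to E w y)"
  shows "\<exists>Z Z'. hereditary_saturated Z \<and> hereditary_saturated Z' \<and> w \<in> Z \<and> v \<in> Z' \<and> Z \<inter> Z' = {}"
proof -
  define avoid where "avoid T = {u \<in> verts E. \<forall>y\<in>T. \<not> connects_to E u y}" for T
  have avoid: "hereditary_saturated (avoid T)"
    if her: "\<And>e. e \<in> arcs E \<Longrightarrow> tail E e \<in> T \<Longrightarrow> head E e \<in> T" for T
    unfolding hereditary_saturated_def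
  proof (intro conjI ballI impI)
    fix e assume e: "e \<in> arcs E" "tail E e \<in> avoid T"
    then show "head E e \<in> avoid T"
      using connects_trans [OF connects_edge [OF e(1)]] by (auto simp: avoid_def)
  next
    fix u assume u: "u \<in> verts E" "out_arcs E u \<noteq> {}" "\<forall>e\<in>out_arcs E u. head E e \<in> avoid T"
    have "False" if y: "y \<in> T" "connects_to E u y" for y
    proof (cases "u = y")
      case True
      obtain e where e: "e \<in> out_arcs E u" using u by blast
      then have "head E e \<in> T" using her [of e] y True by auto
      moreover have "connects_to E (head E e) (head E e)" using e by (intro connects_refl) auto
      ultimately show False using u e by (auto simp: avoid_def)
    next
      case False
      then show False using connects_first_edge [OF y(2)] u y by (auto simp: avoid_def)
    qed
    then show "u \<in> avoid T" using u by (auto simp: avoid_def)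
  qed
  define T where "T = {y. connects_to E v y}"
  have T: "hereditary_saturated (avoid T)"
    by (rule avoid) (auto simp: T_def intro: connects_trans connects_edge)
  have Z: "hereditary_saturated (avoid (avoid T))"
    by (rule avoid) (use T in \<open>simp add: hereditary_saturated_def\<close>)
  have "w \<in> avoid T" using w sep connects_verts by (auto simp: avoid_def T_def)
  moreover have "v \<in> avoid (avoid T)"
  proof -
    have "\<not> connects_to E v y" if "y \<in> avoid T" for y
    proof
      assume vy: "connects_to E v y"
      then have "connects_to E y y" by (auto dest: connects_verts intro: connects_refl)
      then show False using that vy by (auto simp: avoid_def T_def)
    qed
    then show ?thesis using v by (auto simp: avoid_def)
  qed
  moreover have "avoid T \<inter> avoid (avoid T) = {}"
    using connects_refl by (auto simp: avoid_def)
  ultimately show ?thesis using T Z by blast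
qed

lemma prime_imp_MT3:
  assumes pr: "prime_ring L"
  shows "MT3 E"
  unfolding MT3_def
proof (intro ballI, rule ccontr)
  fix v w assume v: "v \<in> verts E" and w: "w \<in> verts E"
    and no: "\<not> (\<exists>y\<in>verts E. connects_to E v y \<and> connects_to E w y)"
  obtain Z Z' where Z: "hereditary_saturated Z" "hereditary_saturated Z'" "w \<in> Z" "v \<in> Z'" "Z \<inter> Z' = {}"
    using separating_sets [OF v w no] by metis
  have "x \<otimes>\<^bsub>L\<^esub> y = \<zero>\<^bsub>L\<^esub>" if "x \<in> cls ` ker Z" "y \<in> cls ` ker Z'" for x y
  proof -
    obtain f g where fg: "f \<in> ker Z" "x = cls f" "g \<in> ker Z'" "y = cls g" using \<open>x \<in> _\<close> \<open>y \<in> _\<close> by blast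
    have C: "f \<in> C" "g \<in> C" using fg free_idealD(1) [OF ker_ideal] by auto
    have "f * g \<in> ker Z" "f * g \<in> ker Z'"
      using fg C by (auto intro: free_idealD(5,6) [OF ker_ideal])
    then have "f * g \<in> N" by (rule disjoint_ker_inter [OF Z(1,2,5)])
    then show ?thesis using fg C by (simp add: L_zero cls_eq_iff)
  qed
  then have "ideal_prod L (cls ` ker Z) (cls ` ker Z') = {\<zero>\<^bsub>L\<^esub>}"
    by (rule ideal_prod_zero) (use vertex_in_ker v w Z in blast)+
  then have "cls ` ker Z = {\<zero>\<^bsub>L\<^esub>} \<or> cls ` ker Z' = {\<zero>\<^bsub>L\<^esub>}"
    by (rule prime_ringD [OF pr image_ideal [OF ker_ideal] image_ideal [OF ker_ideal]])
  moreover have "cls ` ker Y \<noteq> {\<zero>\<^bsub>L\<^esub>}" if "u \<in> Y" "u \<in> verts E" for u Y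
  proof
    assume "cls ` ker Y = {\<zero>\<^bsub>L\<^esub>}"
    then have "cls (P u []) = cls 0" using vertex_in_ker [OF that] unfolding L_zero by blast
    then show False using vertex_not_zero [OF prime_imp_nontrivial [OF pr]] by (simp add: cls_eq_iff)
  qed
  ultimately show False using Z v w by blast
qed

section \<open>Primeness over a domain\<close>

lemma closed_paths_mult:
  assumes "s \<in> span (closed_paths UNIV y)" "t \<in> span (closed_paths UNIV y)"
  shows "s * t \<in> span (closed_paths UNIV y)"
proof (rule span_mult_left [OF assms(2)])
  show "s \<in> C" using assms(1) by simp
  fix t assume "t \<in> closed_paths UNIV y"
  then obtain q where q: "t = P y q" "awalk y q y" "q \<noteq> []" by (auto simp: closed_paths_def)
  show "s * t \<in> span (closed_paths UNIV y)"
  proof (rule span_mult_right [OF assms(1)])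
    show "t \<in> C" using q by auto
    fix s assume "s \<in> closed_paths UNIV y"
    then obtain p where p: "s = P y p" "awalk y p y" "p \<noteq> []" by (auto simp: closed_paths_def)
    have "s * t \<approx> P y (p @ q)" unfolding p q using p q by (intro P_append)
    moreover have "P y (p @ q) \<in> span (closed_paths UNIV y)" using p q by (intro span_generator closed_paths_I) auto
    ultimately show "s * t \<in> span (closed_paths UNIV y)" by (rule span_eqv_sym)
  qed
qed

text \<open>
  Conjugation transports the reduced element along every path that starts at \<open>v\<close>.
\<close>
lemma ideal_contains_perturbed_vertices:
  assumes I: "free_ideal I" "N \<subseteq> I" and f: "f \<in> I" "f \<notin> N"
  shows "\<exists>v\<in>verts E. \<exists>c. c \<noteq> 0 \<and>
    (\<forall>p y. awalk v p y \<longrightarrow> (\<exists>t\<in>span (closed_paths UNIV y). sc c * P y [] + t \<in> I))"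
proof -
  obtain a b c v t where red: "a \<in> C" "b \<in> C" "c \<noteq> 0" "v \<in> verts E" "t \<in> span (closed_paths UNIV v)"
    "a * f * b \<approx> sc c * P v [] + t" using reduction_to_vertex [of f] f free_idealD(1) [OF I(1)] by metis
  have afb: "a * f * b \<in> I" using red f by (intro free_ideal_sandwich [OF I(1)])
  have "\<exists>t\<in>span (closed_paths UNIV y). sc c * P y [] + t \<in> I" if p: "awalk v p y" for p y
  proof -
    from conjugate [OF red(5,6) p] obtain t' where t': "t' \<in> span (closed_paths UNIV y)"
      "G v p * (a * f * b) * P v p \<approx> sc c * P y [] + t'" by (rule bexE)
    have "G v p * (a * f * b) * P v p \<in> I" using p by (intro free_ideal_sandwich [OF I(1) afb]) auto
    then have "sc c * P y [] + t' \<in> I" by (rule free_ideal_eqv [OF I t'(2)])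
    then show ?thesis using t'(1) by blast
  qed
  then show ?thesis using red(3,4) by blast
qed

lemma domain_MT3_imp_prime:
  assumes dom: "integral_domain R" and mt3: "MT3 E" and ne: "verts E \<noteq> {}"
  shows "prime_ring L"
  unfolding prime_ring_def
proof (intro conjI allI impI)
  have dom': "(0::'r) \<noteq> 1" "\<And>a b :: 'r. a \<noteq> 0 \<Longrightarrow> b \<noteq> 0 \<Longrightarrow> a * b \<noteq> 0"
    using dom unfolding integral_domain_def by blast+
  show "carrier L \<noteq> {\<zero>\<^bsub>L\<^esub>}"
  proof
    obtain v where v: "v \<in> verts E" using ne by blast
    assume "carrier L = {\<zero>\<^bsub>L\<^esub>}"
    then have "cls (P v []) = cls 0" using v unfolding L_carrier L_zero by blast
    then show False using vertex_not_zero [OF dom'(1)] by (simp add: cls_eq_iff)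
  qed
  fix I J
  assume I: "two_sided_ideal I L" and J: "two_sided_ideal J L" and IJ: "ideal_prod L I J = {\<zero>\<^bsub>L\<^esub>}"
  show "I = {\<zero>\<^bsub>L\<^esub>} \<or> J = {\<zero>\<^bsub>L\<^esub>}"
  proof (rule ccontr)
    assume "\<not> ?thesis"
    then obtain f g where f: "f \<in> preimage I" "f \<notin> N" and g: "g \<in> preimage J" "g \<notin> N"
      using ideal_nonzero [OF I] ideal_nonzero [OF J] by blast
    obtain v c where v: "v \<in> verts E" "c \<noteq> 0"
      "\<forall>p y. awalk v p y \<longrightarrow> (\<exists>t\<in>span (closed_paths UNIV y). sc c * P y [] + t \<in> preimage I)"
      using ideal_contains_perturbed_vertices [OF preimage_ideal(1,2) [OF I] f] by blast
    obtain w d where w: "w \<in> verts E" "d \<noteq> 0"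
      "\<forall>p y. awalk w p y \<longrightarrow> (\<exists>t\<in>span (closed_paths UNIV y). sc d * P y [] + t \<in> preimage J)"
      using ideal_contains_perturbed_vertices [OF preimage_ideal(1,2) [OF J] g] by blast
    obtain y p q where y: "y \<in> verts E" "awalk v p y" "awalk w q y"
      using mt3 v(1) w(1) unfolding MT3_def connects_to_def by blast
    from v(3) [rule_format, OF y(2)] obtain s where s: "s \<in> span (closed_paths UNIV y)" "sc c * P y [] + s \<in> preimage I" by (rule bexE)
    from w(3) [rule_format, OF y(3)] obtain t where t: "t \<in> span (closed_paths UNIV y)" "sc d * P y [] + t \<in> preimage J" by (rule bexE)
    have yC: "P y [] \<in> C" using y by simp
    have "cls (sc c * P y [] + s) \<otimes>\<^bsub>L\<^esub> cls (sc d * P y [] + t) \<in> ideal_prod L I J"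
      using s t by (intro ideal_prod.prod) (simp_all add: preimage_def)
    then have "cls ((sc c * P y [] + s) * (sc d * P y [] + t)) = cls 0"
      using IJ s t by (simp add: L_zero preimage_def)
    then have zero: "(sc c * P y [] + s) * (sc d * P y [] + t) \<in> N" by (simp add: cls_eq_iff)
    define r where "r = sc c * (P y [] * t) + sc d * (s * P y []) + s * t"
    have "P y [] * t \<in> span (closed_paths UNIV y)"
    proof (rule span_mult_left [OF t(1) yC])
      fix t assume t: "t \<in> closed_paths UNIV y"
      then obtain q where q: "t = P y q" "awalk y q y" by (auto simp: closed_paths_def)
      then have "P y [] * t \<approx> t" using vertex_P by simp
      then show "P y [] * t \<in> span (closed_paths UNIV y)" using span_generator [OF t] by (rule span_eqv_sym)
    qed
    moreover have "s * P y [] \<in> span (closed_paths UNIV y)"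
    proof (rule span_mult_right [OF s(1) yC])
      fix s assume s: "s \<in> closed_paths UNIV y"
      then obtain q where q: "s = P y q" "awalk y q y" by (auto simp: closed_paths_def)
      then have "s * P y [] \<approx> s" using P_vertex by simp
      then show "s * P y [] \<in> span (closed_paths UNIV y)" using span_generator [OF s] by (rule span_eqv_sym)
    qed
    ultimately have r: "r \<in> span (closed_paths UNIV y)"
      unfolding r_def using closed_paths_mult [OF s(1) t(1)] by (intro span_add span_sc)
    have "(sc c * P y [] + s) * (sc d * P y [] + t) = sc (c * d) * (P y [] * P y []) + r"
    proof -
      have "(sc c * P y [] + s) * (sc d * P y [] + t) =
          sc c * P y [] * (sc d * P y []) + (sc c * P y [] * t + s * (sc d * P y []) + s * t)"
        by (simp add: distrib_left distrib_right ac_simps)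
      also have "sc c * P y [] * t = sc c * (P y [] * t)" by (rule mult.assoc)
      also have "s * (sc d * P y []) = sc d * (s * P y [])" by (rule sc_left_commute)
      finally show ?thesis unfolding r_def by (simp only: sc_mult_sc)
    qed
    also have "\<dots> \<approx> sc (c * d) * P y [] + r"
      using y by (intro eqv_add [OF eqv_sc eqv_refl] vertex_mult(1))
    finally have "(sc c * P y [] + s) * (sc d * P y [] + t) \<approx> sc (c * d) * P y [] + r" .
    from eqv_N [OF this] have "sc (c * d) * P y [] + r \<in> N" using zero by simp
    then show False using vertex_notin_N [OF dom'(2) [OF v(2) w(2)] r] by simp
  qed
qed

section \<open>Graded basic ideals\<close>

lemma lin_span_image:
  assumes "S \<subseteq> C"
  shows "lin_span L (cls ` S) = cls ` span S"
proof (intro equalityI subsetI)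
  fix x assume "x \<in> lin_span L (cls ` S)"
  then show "x \<in> cls ` span S"
  proof (induction rule: lin_span.induct)
    case zero
    then show ?case unfolding L_zero by (intro imageI span.base) simp
  next
    case (add_smult x y c)
    then obtain s z where "s \<in> S" "x = cls s" "z \<in> span S" "y = cls z" by blast
    then show ?case using span.step by simp
  qed
next
  fix x assume "x \<in> cls ` span S"
  then obtain f where f: "f \<in> span S" "x = cls f" by blast
  have "cls f \<in> lin_span L (cls ` S)"
    using f(1)
  proof (induction rule: span.induct)
    case (base x)
    then have "cls x = \<zero>\<^bsub>L\<^esub>" by (simp add: L_zero cls_eq_iff)
    then show ?case by (simp add: lin_span.zero)
  next
    case (step s y c)
    then show ?case using lin_span.add_smult [of "cls s" "cls ` S" "cls y" L c] by simp
  qed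
  then show "x \<in> lin_span L (cls ` S)" using f by simp
qed

lemma homogeneous_eq: "homogeneous R E k = cls ` span (monomials {k})"
proof -
  have "{path_elem R E u p \<otimes>\<^bsub>L\<^esub> ghost_elem R E u' q | u p u' q.
        (\<exists>w. awalk u p w \<and> awalk u' q w) \<and> int (length p) - int (length q) = k} = cls ` monomials {k}"
  proof (intro equalityI subsetI)
    fix x assume "x \<in> {path_elem R E u p \<otimes>\<^bsub>L\<^esub> ghost_elem R E u' q | u p u' q.
        (\<exists>w. awalk u p w \<and> awalk u' q w) \<and> int (length p) - int (length q) = k}"
    then obtain u p u' q w where x: "x = path_elem R E u p \<otimes>\<^bsub>L\<^esub> ghost_elem R E u' q" and
      w: "awalk u p w" "awalk u' q w" "int (length p) - int (length q) \<in> {k}" by blast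
    have "x = cls (P u p * G u' q)" unfolding x path_elem_def ghost_elem_def using w by (intro L_mult) auto
    then show "x \<in> cls ` monomials {k}" using monomials_I [OF w] by blast
  next
    fix x assume "x \<in> cls ` monomials {k}"
    then obtain u p u' q w where x: "x = cls (P u p * G u' q)" and
      w: "awalk u p w" "awalk u' q w" "int (length p) - int (length q) = k" unfolding monomials_def by blast
    have "x = path_elem R E u p \<otimes>\<^bsub>L\<^esub> ghost_elem R E u' q"
      unfolding x path_elem_def ghost_elem_def using w by (intro L_mult [symmetric]) auto
    then show "x \<in> {path_elem R E u p \<otimes>\<^bsub>L\<^esub> ghost_elem R E u' q | u p u' q.
        (\<exists>w. awalk u p w \<and> awalk u' q w) \<and> int (length p) - int (length q) = k}" using w by blast
  qed
  then show ?thesis unfolding homogeneous_def using lin_span_image [OF path_sets_in_C(1)] by simp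
qed

text \<open>
  A nonzero graded ideal contains a nonzero homogeneous element, which reduces to a multiple of a vertex
  without further terms; the scalar is removed because the ideal is basic.
\<close>
lemma graded_basic_contains_vertex:
  assumes gr: "graded_ideal R E I" and ba: "basic_ideal R E I" and nz: "I \<noteq> {\<zero>\<^bsub>L\<^esub>}"
  shows "\<exists>v\<in>verts E. \<forall>y. connects_to E v y \<longrightarrow> vertex R E y \<in> I"
proof -
  have I: "two_sided_ideal I L" using gr by (simp add: graded_ideal_def)
  note pre = preimage_ideal [OF I]
  obtain f where f: "f \<in> preimage I" "f \<notin> N" using ideal_nonzero [OF I] nz by blast
  then have "cls f \<in> I" by (simp add: preimage_def)
  from ex1_implies_ex [OF bspec [OF conjunct2 [OF gr [unfolded graded_ideal_def]] this]]
  obtain c where "(\<forall>k. c k \<in> I \<inter> homogeneous R E k) \<and> finite {k. c k \<noteq> \<zero>\<^bsub>L\<^esub>} \<and>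
      cls f = finsum L c {k. c k \<noteq> \<zero>\<^bsub>L\<^esub>}" by (rule exE)
  then have c: "\<And>k. c k \<in> I \<inter> homogeneous R E k" "cls f = finsum L c {k. c k \<noteq> \<zero>\<^bsub>L\<^esub>}"
    by simp_all
  have "{k. c k \<noteq> \<zero>\<^bsub>L\<^esub>} \<noteq> {}"
  proof
    assume "{k. c k \<noteq> \<zero>\<^bsub>L\<^esub>} = {}"
    then have "cls f = \<zero>\<^bsub>L\<^esub>" using c(2) by simp
    then show False using f by (simp add: L_zero cls_eq_iff)
  qed
  then obtain k where k: "c k \<noteq> \<zero>\<^bsub>L\<^esub>" by blast
  obtain h where h: "h \<in> span (monomials {k})" "c k = cls h" using c(1) [of k] unfolding homogeneous_eq by blast
  have "h \<notin> N" using k h by (auto simp: L_zero cls_eq_iff)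
  then obtain a b d v where red: "a \<in> C" "b \<in> C" "d \<noteq> 0" "v \<in> verts E" "a * h * b \<approx> sc d * P v []"
    using reduction_homogeneous [OF h(1)] by metis
  have "h \<in> preimage I" using h c(1) [of k] by (simp add: preimage_def)
  then have "a * h * b \<in> preimage I" using red by (intro free_ideal_sandwich [OF pre(1)])
  then have "sc d * P v [] \<in> preimage I" by (rule free_ideal_eqv [OF pre(1,2) red(5)])
  then have "d \<odot>\<^bsub>L\<^esub> vertex R E v \<in> I" by (simp add: vertex_cls preimage_def)
  then have "vertex R E v \<in> I" using ba red(3,4) unfolding basic_ideal_def by blast
  then have v: "P v [] \<in> preimage I" using red(4) by (simp add: vertex_cls preimage_def)
  have "vertex R E y \<in> I" if p: "awalk v p y" for p y
  proof -
    have "G v p * P v [] * P v p \<in> preimage I" using p by (intro free_ideal_sandwich [OF pre(1) v]) auto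
    moreover have "G v p * P v [] * P v p \<approx> P y []"
    proof -
      have "G v p * P v [] * P v p \<approx> G v p * P v p" using p by (auto intro!: eqv_mult_right G_vertex)
      also have "\<dots> \<approx> P y []" using GP_prefix [OF p, of "[]" y] p by (auto dest: awalk_last_in_verts)
      finally show ?thesis .
    qed
    ultimately have "P y [] \<in> preimage I" by (rule free_ideal_eqv [OF pre(1,2), rotated])
    then show ?thesis by (simp add: vertex_cls preimage_def)
  qed
  then show ?thesis using red(4) unfolding connects_to_def by blast
qed

lemma MT3_imp_common_vertex:
  assumes "MT3 E"
    and "graded_ideal R E I" "basic_ideal R E I" "I \<noteq> {\<zero>\<^bsub>L\<^esub>}"
    and "graded_ideal R E J" "basic_ideal R E J" "J \<noteq> {\<zero>\<^bsub>L\<^esub>}"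
  shows "I \<inter> J \<inter> vertex R E ` verts E \<noteq> {}"
proof -
  obtain v where v: "v \<in> verts E" "\<forall>y. connects_to E v y \<longrightarrow> vertex R E y \<in> I"
    using graded_basic_contains_vertex [OF assms(2-4)] by blast
  obtain w where w: "w \<in> verts E" "\<forall>y. connects_to E w y \<longrightarrow> vertex R E y \<in> J"
    using graded_basic_contains_vertex [OF assms(5-7)] by blast
  obtain y where "y \<in> verts E" "connects_to E v y" "connects_to E w y"
    using assms(1) v(1) w(1) unfolding MT3_def by blast
  then show ?thesis using v(2) w(2) by blast
qed

lemma homogeneous_decomposition:
  assumes "x \<in> span (monomials UNIV)"
  shows "\<exists>A h. finite A \<and> (\<forall>k. h k \<in> span (monomials {k})) \<and> (\<forall>k. k \<notin> A \<longrightarrow> h k = 0) \<and> x \<approx> (\<Sum>k\<in>A. h k)"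
  using assms
proof (induction rule: span.induct)
  case (base x)
  then show ?case by (intro exI [of _ "{}"] exI [of _ "\<lambda>_. 0"]) (auto intro: span.base)
next
  case (step s y c)
  then obtain A h where A: "finite A" "\<And>k. h k \<in> span (monomials {k})" "\<And>k. k \<notin> A \<Longrightarrow> h k = 0"
    "y \<approx> (\<Sum>k\<in>A. h k)" by metis
  obtain d where d: "s \<in> monomials {d}" using step(1) unfolding monomials_def by blast
  define h' where "h' = (\<lambda>k. (if k = d then sc c * s else 0) + h k)"
  have "(\<Sum>k\<in>insert d A. h' k) = sc c * s + (\<Sum>k\<in>insert d A. h k)"
    unfolding h'_def sum.distrib using A(1) by simp
  also have "(\<Sum>k\<in>insert d A. h k) = (\<Sum>k\<in>A. h k)"
    using A(1,3) by (intro sum.mono_neutral_right) auto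
  finally have "sc c * s + y \<approx> (\<Sum>k\<in>insert d A. h' k)" using eqv_add [OF eqv_refl A(4)] by simp
  moreover have "h' k \<in> span (monomials {k})" for k
    unfolding h'_def using A(2) d by (intro span_add) (auto intro: span_sc span_generator span.base)
  moreover have "h' k = 0" if "k \<notin> insert d A" for k using A(3) that by (simp add: h'_def)
  ultimately show ?case using A(1) by (metis finite_insert)
qed

lemma finsum_support:
  assumes "\<And>k. h k \<in> C" "finite A" "{k. cls (h k) \<noteq> \<zero>\<^bsub>L\<^esub>} \<subseteq> A"
  shows "finsum L (\<lambda>k. cls (h k)) {k. cls (h k) \<noteq> \<zero>\<^bsub>L\<^esub>} = cls (\<Sum>k\<in>A. h k)"
proof -
  let ?B = "{k. cls (h k) \<noteq> \<zero>\<^bsub>L\<^esub>}"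
  have fin: "finite ?B" using assms finite_subset by blast
  have "(\<Sum>k\<in>A. h k) \<approx> (\<Sum>k\<in>A. if k \<in> ?B then h k else 0)"
    by (rule eqv_sum) (auto simp: L_zero cls_eq_iff)
  also have "\<dots> = (\<Sum>k\<in>?B. h k)"
    using assms(2,3) by (intro sum.mono_neutral_cong_right) auto
  finally have "cls (\<Sum>k\<in>A. h k) = cls (\<Sum>k\<in>?B. h k)" by (simp add: cls_eq_iff)
  then show ?thesis using L_finsum [OF fin] assms(1) by simp
qed

text \<open>
  The components of an element of the kernel lie in the kernel by \<open>ker_components\<close>. They are unique by the
  same lemma for \<open>Z = {}\<close>, whose representation is faithful.
\<close>
lemma ker_graded:
  assumes Z: "hereditary_saturated Z"
  shows "graded_ideal R E (cls ` ker Z)"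
  unfolding graded_ideal_def
proof (intro conjI ballI)
  show "two_sided_ideal (cls ` ker Z) L" by (rule image_ideal [OF ker_ideal])
  fix x assume "x \<in> cls ` ker Z"
  then obtain f where f: "f \<in> ker Z" "x = cls f" by blast
  have "f \<in> C" using f(1) by (rule free_idealD(1) [OF ker_ideal])
  then obtain A h where A: "finite A" "\<And>k. h k \<in> span (monomials {k})" "\<And>k. k \<notin> A \<Longrightarrow> h k = 0"
    "f \<approx> (\<Sum>k\<in>A. h k)" using homogeneous_decomposition [OF C_span] by metis
  have hC: "h k \<in> C" for k using A(2) by (rule span_sets_C(1))
  have sum: "(\<Sum>k\<in>A. h k) \<in> ker Z" using free_ideal_eqv [OF ker_ideal N_subset_ker [OF Z] A(4) f(1)] .
  have hk: "h k \<in> ker Z" for k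
  proof (cases "k \<in> A")
    case True
    then show ?thesis using ker_components [of A Z h, OF monomial_shifts [OF Z A(2)] hC A(1) sum] by blast
  next
    case False
    then show ?thesis using A(3) free_idealD(2) [OF ker_ideal] by simp
  qed
  have supp: "{k. cls (h k) \<noteq> \<zero>\<^bsub>L\<^esub>} \<subseteq> A" using A(3) by (auto simp: L_zero)
  show "\<exists>!c. (\<forall>k. c k \<in> cls ` ker Z \<inter> homogeneous R E k) \<and> finite {k. c k \<noteq> \<zero>\<^bsub>L\<^esub>} \<and>
      x = finsum L c {k. c k \<noteq> \<zero>\<^bsub>L\<^esub>}"
  proof (rule ex1I [of _ "\<lambda>k. cls (h k)"], intro conjI allI)
    show "cls (h k) \<in> cls ` ker Z \<inter> homogeneous R E k" for k
      unfolding homogeneous_eq using hk A(2) by blast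
    show "finite {k. cls (h k) \<noteq> \<zero>\<^bsub>L\<^esub>}" using supp A(1) by (rule finite_subset)
    show "x = finsum L (\<lambda>k. cls (h k)) {k. cls (h k) \<noteq> \<zero>\<^bsub>L\<^esub>}"
      unfolding finsum_support [OF hC A(1) supp] f(2) cls_eq_iff by (rule A(4))
    fix c assume c: "(\<forall>k. c k \<in> cls ` ker Z \<inter> homogeneous R E k) \<and> finite {k. c k \<noteq> \<zero>\<^bsub>L\<^esub>} \<and>
      x = finsum L c {k. c k \<noteq> \<zero>\<^bsub>L\<^esub>}"
    have "\<forall>k. \<exists>g. g \<in> span (monomials {k}) \<and> c k = cls g" using c unfolding homogeneous_eq by blast
    then obtain g where g: "\<And>k. g k \<in> span (monomials {k})" "\<And>k. c k = cls (g k)" by metis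
    have c_eq: "c = (\<lambda>k. cls (g k))" using g(2) by blast
    have gC: "g k \<in> C" for k using g(1) by (rule span_sets_C(1))
    define B where "B = A \<union> {k. cls (g k) \<noteq> \<zero>\<^bsub>L\<^esub>}"
    have B: "finite B" using A(1) c by (simp add: B_def c_eq)
    have "cls (\<Sum>k\<in>B. g k) = cls (\<Sum>k\<in>B. h k)"
    proof -
      have "cls (\<Sum>k\<in>B. g k) = x" using c finsum_support [OF gC B] unfolding c_eq B_def by simp
      also have "x = cls (\<Sum>k\<in>A. h k)" using f A(4) by (simp add: cls_eq_iff)
      also have "(\<Sum>k\<in>A. h k) = (\<Sum>k\<in>B. h k)" using B A(3) by (intro sum.mono_neutral_left) (auto simp: B_def)
      finally show ?thesis .
    qed
    then have "(\<Sum>k\<in>B. g k - h k) \<in> N" by (simp add: cls_eq_iff eqv_def sum_subtractf)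
    then have gh: "(\<Sum>k\<in>B. g k - h k) \<in> ker {}" using N_subset_ker [OF hereditary_saturated_empty] by blast
    have "g k - h k \<in> N" for k
    proof (cases "k \<in> B")
      case True
      have "g k - h k \<in> ker {}"
        using ker_components [of B "{}" "\<lambda>k. g k - h k", OF monomial_shifts [OF hereditary_saturated_empty span_diff [OF g(1) A(2)]]
            C_diff [OF gC hC] B gh True] .
      then show ?thesis by (rule faithful)
    next
      case False
      then have "cls (g k) = cls 0" "h k = 0" using A(3) by (auto simp: B_def L_zero)
      then show ?thesis by (simp add: cls_eq_iff)
    qed
    then show "c = (\<lambda>k. cls (h k))" unfolding c_eq by (intro ext) (simp add: cls_eq_iff eqv_def)
  qed
qed

text \<open>
  The operators act on functions with values in the domain \<open>R\<close>.
\<close>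
lemma ker_scalar_cancel:
  assumes dom: "integral_domain R" and "c \<noteq> 0" "sc c * f \<in> ker Z" "f \<in> C"
  shows "f \<in> ker Z"
proof -
  have "act Z f \<phi> u m k = 0" for \<phi> u m k
    using kerD [OF assms(3), of \<phi> u m k] dom assms(2) unfolding act_sc integral_domain_def by blast
  then show ?thesis using assms(4) by (simp add: ker_def)
qed

lemma vertex_gap_cls:
  assumes "v \<in> verts E" "finite S" "S \<subseteq> out_arcs E v"
  shows "\<exists>g\<in>C. vertex_gap R E v S = cls g"
proof -
  have gen: "gen (Edge e) \<in> C" "gen (Ghost e) \<in> C" if "e \<in> S" for e
  proof -
    have "e \<in> arcs E" using that assms(3) by auto
    then show "gen (Edge e) \<in> C" "gen (Ghost e) \<in> C" by (auto simp: generators_def)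
  qed
  have "finsum L (\<lambda>e. edge R E e \<otimes>\<^bsub>L\<^esub> ghost R E e) S = finsum L (\<lambda>e. cls (gen (Edge e) * gen (Ghost e))) S"
    using gen by (intro L.finsum_cong') (auto simp: edge_def ghost_def L_carrier)
  also have "\<dots> = cls (\<Sum>e\<in>S. gen (Edge e) * gen (Ghost e))"
    using assms(2) gen by (intro L_finsum) auto
  finally have "vertex_gap R E v S = cls (P v []) \<ominus>\<^bsub>L\<^esub> cls (\<Sum>e\<in>S. gen (Edge e) * gen (Ghost e))"
    by (simp add: vertex_gap_def vertex_cls)
  also have "\<dots> = cls (P v [] - (\<Sum>e\<in>S. gen (Edge e) * gen (Ghost e)))"
    using assms gen by (intro L_diff) auto
  finally show ?thesis using assms gen by blast
qed

lemma ker_basic: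
  assumes Z: "hereditary_saturated Z" and dom: "integral_domain R"
  shows "basic_ideal R E (cls ` ker Z)"
proof -
  have cancel: "cls f \<in> cls ` ker Z" if "c \<noteq> 0" "c \<odot>\<^bsub>L\<^esub> cls f \<in> cls ` ker Z" "f \<in> C" for c f
  proof -
    have "sc c * f \<in> ker Z" using that(2) image_eq_iff [OF N_subset_ker [OF Z] ker_ideal] by simp
    then show ?thesis using ker_scalar_cancel [OF dom that(1)] that(3) by blast
  qed
  have "vertex R E v \<in> cls ` ker Z" if "c \<noteq> 0" "v \<in> verts E" "c \<odot>\<^bsub>L\<^esub> vertex R E v \<in> cls ` ker Z" for c v
    using cancel [OF that(1), of "P v []"] that(2,3) by (simp add: vertex_cls)
  moreover have "vertex_gap R E v S \<in> cls ` ker Z"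
    if "c \<noteq> 0" "v \<in> verts E" "finite S" "S \<subseteq> out_arcs E v" "c \<odot>\<^bsub>L\<^esub> vertex_gap R E v S \<in> cls ` ker Z" for c v S
    using vertex_gap_cls [OF that(2-4)] cancel [OF that(1)] that(5) by auto
  ultimately show ?thesis
    unfolding basic_ideal_def using image_ideal [OF ker_ideal, of Z] by simp
qed

lemma common_vertex_imp_MT3:
  assumes dom: "integral_domain R"
    and common: "\<And>I J. graded_ideal R E I \<Longrightarrow> basic_ideal R E I \<Longrightarrow> I \<noteq> {\<zero>\<^bsub>L\<^esub>} \<Longrightarrow>
      graded_ideal R E J \<Longrightarrow> basic_ideal R E J \<Longrightarrow> J \<noteq> {\<zero>\<^bsub>L\<^esub>} \<Longrightarrow> I \<inter> J \<inter> vertex R E ` verts E \<noteq> {}"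
  shows "MT3 E"
  unfolding MT3_def
proof (intro ballI, rule ccontr)
  have one: "(0::'r) \<noteq> 1" using dom by (simp add: integral_domain_def)
  fix v w assume v: "v \<in> verts E" and w: "w \<in> verts E"
    and no: "\<not> (\<exists>y\<in>verts E. connects_to E v y \<and> connects_to E w y)"
  obtain Z Z' where Z: "hereditary_saturated Z" "hereditary_saturated Z'" "w \<in> Z" "v \<in> Z'" "Z \<inter> Z' = {}"
    using separating_sets [OF v w no] by metis
  have nz: "cls ` ker Y \<noteq> {\<zero>\<^bsub>L\<^esub>}" if "u \<in> Y" "u \<in> verts E" for u Y
  proof
    assume "cls ` ker Y = {\<zero>\<^bsub>L\<^esub>}"
    then have "cls (P u []) = cls 0" using vertex_in_ker [OF that] unfolding L_zero by blast
    then show False using vertex_not_zero [OF one] by (simp add: cls_eq_iff)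
  qed
  have "cls ` ker Z \<inter> cls ` ker Z' \<inter> vertex R E ` verts E \<noteq> {}"
    by (rule common [OF ker_graded [OF Z(1)] ker_basic [OF Z(1) dom] nz [OF Z(3) w]
          ker_graded [OF Z(2)] ker_basic [OF Z(2) dom] nz [OF Z(4) v]])
  then obtain u where "cls (P u []) \<in> cls ` ker Z" "cls (P u []) \<in> cls ` ker Z'"
    unfolding vertex_cls by blast
  then have "P u [] \<in> ker Z" "P u [] \<in> ker Z'"
    using image_eq_iff [OF N_subset_ker ker_ideal] Z(1,2) by blast+
  then have "P u [] \<in> N" by (rule disjoint_ker_inter [OF Z(1,2,5)])
  then show False using vertex_not_zero [OF one] by simp
qed

end

theorem proposition4p5:
  fixes R :: "'r::{comm_ring, comm_monoid_mult} itself"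
    and E :: "('v, 'e) pre_digraph"
  assumes "wf_digraph E"
    and "countable (verts E)" and "countable (arcs E)"
    and "verts E \<noteq> {}"
  shows "(prime_ring (leavitt R E) \<longleftrightarrow> integral_domain R \<and> MT3 E) \<and>
    (integral_domain R \<and> MT3 E \<longleftrightarrow>
      integral_domain R \<and>
      (\<forall>I J. graded_ideal R E I \<and> basic_ideal R E I \<and> I \<noteq> {\<zero>\<^bsub>leavitt R E\<^esub>} \<longrightarrow>
             graded_ideal R E J \<and> basic_ideal R E J \<and> J \<noteq> {\<zero>\<^bsub>leavitt R E\<^esub>} \<longrightarrow>
             I \<inter> J \<inter> vertex R E ` verts E \<noteq> {}))"
proof -
  interpret leavitt_graph E R
    using assms by (intro leavitt_graph.intro leavitt_graph_axioms.intro)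
  obtain v where v: "v \<in> verts E" using assms(4) by blast
  define common where "common \<longleftrightarrow>
      (\<forall>I J. graded_ideal R E I \<and> basic_ideal R E I \<and> I \<noteq> {\<zero>\<^bsub>L\<^esub>} \<longrightarrow>
             graded_ideal R E J \<and> basic_ideal R E J \<and> J \<noteq> {\<zero>\<^bsub>L\<^esub>} \<longrightarrow>
             I \<inter> J \<inter> vertex R E ` verts E \<noteq> {})"
  have "prime_ring L \<longleftrightarrow> integral_domain R \<and> MT3 E"
    using prime_imp_domain [OF _ v] prime_imp_MT3 domain_MT3_imp_prime [OF _ _ assms(4)] by blast
  moreover have "MT3 E" if "integral_domain R" "common"
  proof (rule common_vertex_imp_MT3 [OF that(1)])
    fix I J
    assume "graded_ideal R E I" "basic_ideal R E I" "I \<noteq> {\<zero>\<^bsub>L\<^esub>}"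
      "graded_ideal R E J" "basic_ideal R E J" "J \<noteq> {\<zero>\<^bsub>L\<^esub>}"
    with that(2) show "I \<inter> J \<inter> vertex R E ` verts E \<noteq> {}" by (simp add: common_def)
  qed
  moreover have "common" if "MT3 E"
    unfolding common_def by (intro allI impI MT3_imp_common_vertex [OF that]) simp_all
  ultimately show ?thesis unfolding common_def [symmetric] by blast
qed

end
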